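(* Assume (A1)–(A4) and (A6). Let $K\ge1$ be a fixed integer, run SLPMM with $\alpha=\sqrt K$ and $\sigma=1/\sqrt K$, let $\bar x^K:=\frac1K\sum_{k=0}^{K-1}x^k$, and let $x^*$ be any optimal solution of $\min\{f(x):x\in\Phi\}$. Then for every $\rho\ge0$, $$\Pr\Big[f(\bar x^K)-f(x^* )\le\sqrt{2\rho}\,\nu_g\Big(\frac{\kappa_0+\kappa_1+2\kappa_3}{\sqrt K}+\frac{\frac{16\beta_0^2}{\varepsilon_0}(\rho+\log K)}{\sqrt K}+\frac{\kappa_2}{K}\Big)+\frac{2\sigma_o\rho}{\sqrt K}+\frac{\theta_5}{\sqrt K}\Big]\ge1-2\exp(-\rho^2/3)-2\exp(-\rho),$$ where $\theta_5:=(\kappa_f^2+\nu_g^2+R^2)/2$.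
   Context: Let $\mathcal C\subset\mathbb R^n$ be a nonempty compact convex set. Let $\xi$ be a random vector whose distribution is supported on $\Xi\subseteq\mathbb R^q$, and let $F:\mathcal C\times\Xi\to\mathbb R$ and $G_i:\mathcal C\times\Xi\to\mathbb R$ ($i=1,\dots,p$) be such that $F(\cdot,\xi)$, $G_i(\cdot,\xi)$ are convex and continuous on $\mathcal C$ for every $\xi$, and $f(x):=\mathbb E[F(x,\xi)]$, $g_i(x):=\mathbb E[G_i(x,\xi)]$ are finite on $\mathcal C$. Write $G=(G_1,\dots,G_p)^T$. The feasible set is $\Phi:=\{x\in\mathcal C: g_i(x)\le0,\ i=1,\dots,p\}$. Stochastic subgradients: $v_0(x,\xi)\in\partial_xF(x,\xi)$, $v_i(x,\xi)\in\partial_xG_i(x,\xi)$. $[t]_+=\max\{t,0\}$, $[t]_+^2=(\max\{t,0\})^2$. SLPMM: fix $\sigma,\alpha>0$, $x^0\in\mathcal C$, $\lambda^0=0\in\mathbb R^p$, i.i.d. copies $\xi^0,\xi^1,\dots$ of $\xi$. For $k\ge0$, $x^{k+1}=\arg\min_{x\in\mathcal C}\{\mathcal L^k_\sigma(x,\lambda^k)+\frac{\alpha}{2}\|x-x^k\|^2\}$ with $\mathcal L^k_\sigma(x,\lambda):=F(x^k,\xi^k)+\langle v_0(x^k,\xi^k),x-x^k\rangle+\frac{1}{2\sigma}[\sum_{i=1}^p[\lambda_i+\sigma(G_i(x^k,\xi^k)+\langle v_i(x^k,\xi^k),x-x^k\rangle)]_+^2-\|\lambda\|^2]$, and $\lambda_i^{k+1}=[\lambda_i^k+\sigma(G_i(x^k,\xi^k)+\langle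 v_i(x^k,\xi^k),x^{k+1}-x^k\rangle)]_+$. Assumptions: (A1) $\|x'-x''\|\le R$ on $\mathcal C$. (A2) $\|G(x,\xi)\|\le\nu_g$ for all $x\in\mathcal C,\xi\in\Xi$. (A3) $\|v_0(x,\xi)\|\le\kappa_f$, $\|v_i(x,\xi)\|\le\kappa_g$ for all $x,\xi$. (A4) (Slater) there exist $\varepsilon_0>0$ and $\hat x\in\mathcal C$ with $g_i(\hat x)\le-\varepsilon_0$ for all $i$. (A6) There is $\sigma_o>0$ with $\mathbb E[\exp(|F(x,\xi)-f(x)|^2/\sigma_o^2)]\le\exp(1)$ for all $x\in\mathcal C$. Constants: $\beta_0:=\nu_g+\sqrt p\,\kappa_gR$, $\kappa_0:=\frac{2\kappa_fR}{\varepsilon_0}$, $\kappa_1:=\frac{R^2}{\varepsilon_0}$, $\kappa_2:=\frac{\nu_g^2}{\varepsilon_0}-\beta_0$, $\kappa_3:=2\beta_0+\frac{\varepsilon_0}{2}+\frac{8\beta_0^2}{\varepsilon_0}\log\frac{32\beta_0^2}{\varepsilon_0^2}$. *)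

theory Defs
  imports "HOL-Probability.Probability"
begin

definition is_subgrad_on :: "'a::real_inner set \<Rightarrow> ('a \<Rightarrow> real) \<Rightarrow> 'a \<Rightarrow> 'a \<Rightarrow> bool" where
  "is_subgrad_on C h x u \<longleftrightarrow> (\<forall>y\<in>C. h x + inner u (y - x) \<le> h y)"

text \<open>The linearized augmented Lagrangian L^k_sigma(y, lam) built at the point x with sample z.
  Constraint indices are 1..p; lam :: nat => real holds the multipliers.\<close>
definition slpmm_L ::
  "('a::real_inner \<Rightarrow> 'q \<Rightarrow> real) \<Rightarrow> (nat \<Rightarrow> 'a \<Rightarrow> 'q \<Rightarrow> real) \<Rightarrow> ('a \<Rightarrow> 'q \<Rightarrow> 'a) \<Rightarrow>
   (nat \<Rightarrow> 'a \<Rightarrow> 'q \<Rightarrow> 'a) \<Rightarrow> nat \<Rightarrow> real \<Rightarrow> 'a \<Rightarrow> 'q \<Rightarrow> (nat \<Rightarrow> real) \<Rightarrow> 'a \<Rightarrow> real" where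
  "slpmm_L F G v0 v p \<sigma> x z lam y =
     F x z + inner (v0 x z) (y - x)
     + (1 / (2 * \<sigma>)) * ((\<Sum>i=1..p. (max (lam i + \<sigma> * (G i x z + inner (v i x z) (y - x))) 0)\<^sup>2)
                          - (\<Sum>i=1..p. (lam i)\<^sup>2))"

definition slpmm_step ::
  "'a::real_inner set \<Rightarrow> ('a \<Rightarrow> 'q \<Rightarrow> real) \<Rightarrow> (nat \<Rightarrow> 'a \<Rightarrow> 'q \<Rightarrow> real) \<Rightarrow> ('a \<Rightarrow> 'q \<Rightarrow> 'a) \<Rightarrow>
   (nat \<Rightarrow> 'a \<Rightarrow> 'q \<Rightarrow> 'a) \<Rightarrow> nat \<Rightarrow> real \<Rightarrow> real \<Rightarrow> 'a \<times> (nat \<Rightarrow> real) \<Rightarrow> 'q \<Rightarrow> 'a \<times> (nat \<Rightarrow> real)" where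
  "slpmm_step C F G v0 v p \<sigma> \<alpha> xl z =
     (let x = fst xl; lam = snd xl;
          x' = arg_min_on (\<lambda>y. slpmm_L F G v0 v p \<sigma> x z lam y + \<alpha> / 2 * (norm (y - x))\<^sup>2) C
      in (x', \<lambda>i. max (lam i + \<sigma> * (G i x z + inner (v i x z) (x' - x))) 0))"

primrec slpmm_iter ::
  "'a::real_inner set \<Rightarrow> ('a \<Rightarrow> 'q \<Rightarrow> real) \<Rightarrow> (nat \<Rightarrow> 'a \<Rightarrow> 'q \<Rightarrow> real) \<Rightarrow> ('a \<Rightarrow> 'q \<Rightarrow> 'a) \<Rightarrow>
   (nat \<Rightarrow> 'a \<Rightarrow> 'q \<Rightarrow> 'a) \<Rightarrow> nat \<Rightarrow> real \<Rightarrow> real \<Rightarrow> 'a \<Rightarrow> (nat \<Rightarrow> 'q) \<Rightarrow> nat \<Rightarrow> 'a \<times> (nat \<Rightarrow> real)" where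
  "slpmm_iter C F G v0 v p \<sigma> \<alpha> x0 zs 0 = (x0, \<lambda>_. 0)"
| "slpmm_iter C F G v0 v p \<sigma> \<alpha> x0 zs (Suc k) =
     slpmm_step C F G v0 v p \<sigma> \<alpha> (slpmm_iter C F G v0 v p \<sigma> \<alpha> x0 zs k) (zs k)"

end

theory Submission
  imports Defs
begin

text \<open>
  Strong convexity of the proximal subproblem yields a three-point inequality for each step.
  At \<open>xstar\<close>, summing over \<open>k < K\<close> bounds the gap of the sampled objectives by
  \<open>sqrt K * \<theta>5\<close> plus the sum of \<open>\<langle>lam\<^sup>k, G(xstar, \<xi>\<^sup>k)\<rangle>\<close>.  Replacing sampled by expected objectives costs
  two sums of sub-Gaussian martingale differences, each exceeding \<open>\<rho> * \<sigma>o * sqrt K\<close> with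
  probability at most \<open>exp (- \<rho>\<^sup>2 / 3)\<close>.  The multiplier sum is a supermartingale with
  increments bounded by \<open>\<nu>g * norm lam\<^sup>k\<close>, so Azuma--Hoeffding applies once the multipliers are
  truncated at a level \<open>B\<close>.

  At the Slater point, the three-point inequality gives \<open>norm lam\<^sup>k\<close> a negative drift over
  \<open>s = \<lceil>sqrt K\<rceil>\<close> steps above a threshold.  As its increments are bounded, this bounds an exponential
  moment of \<open>norm lam\<^sup>k\<close> uniformly in \<open>k\<close>; \<open>B\<close> is the level for which each \<open>norm lam\<^sup>k\<close>
  exceeds \<open>B\<close> with probability at most \<open>exp (- \<rho>) / K\<close>.
\<close>

subsection \<open>Real inequalities\<close>

text \<open>The proximal term dictates the window length \<open>s\<close>. Over \<open>s\<close>
  steps the squared distances to the Slater point telescope to at most \<open>R^2\<close>, while the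
  gain from the Slater gap grows with \<open>s\<close>, so the threshold contains
  \<open>\<alpha> * R^2 / (\<epsilon> * s)\<close>. For \<open>s = 1\<close> this is of order
  \<open>sqrt K\<close>; for \<open>s\<close> about \<open>sqrt K\<close> it is at most
  \<open>R^2 / \<epsilon>\<close>. Rounding \<open>s\<close> up costs
  \<open>\<sigma> * s \<le> 2\<close>, which is the origin of the factors in
  \<open>2 * \<kappa>3\<close> and \<open>16 * \<beta>0^2\<close>. The energy inequality bounds
  squares of multiplier norms only; passing to the norms themselves is the delicate part of the
  drift estimate. Conditional expectations are avoided: the drift is tested against
  history-measurable weights, and exponential moments are integrated over the newest sample with the
  history frozen. The exponent \<open>\<rho>^2 / 3\<close> is what the moment bound
  \<open>exp (3/4 * t^2 * s^2)\<close> yields after optimizing \<open>t\<close>. One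
  \<open>exp (- \<rho>)\<close> pays for the truncated multiplier sum, the other for a union bound
  over the truncation events.\<close>

lemma exp_le_quadratic_nonpos: "exp x \<le> 1 + x + x\<^sup>2 / 2" if "x \<le> 0" for x :: real
proof -
  obtain t where t: "exp x = (\<Sum>m<3. x ^ m / fact m) + exp t / fact 3 * x ^ 3"
    using Maclaurin_exp_le[of x 3] by blast
  have "x ^ 3 \<le> 0"
    using that by (simp add: power_le_zero_eq)
  then have "exp t / fact 3 * x ^ 3 \<le> 0"
    by (intro mult_nonneg_nonpos) auto
  then show ?thesis
    using t by (simp add: numeral_3_eq_3 power2_eq_square)
qed

text \<open>For \<open>x \<le> 0\<close> the quadratic Taylor bound suffices, and for
  \<open>x \<ge> 16/9\<close> the exponents are already ordered. In between, a degree 6 upper bound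
  for \<open>exp x\<close> is compared with a degree 3 lower bound in
  \<open>9 * x^2 / 16\<close>.\<close>

lemma exp_le_add_exp_square: "exp x \<le> x + exp (9 * x\<^sup>2 / 16)" for x :: real
proof (cases "x \<le> 0")
  case True
  then have "exp x \<le> 1 + x + x\<^sup>2 / 2"
    by (intro exp_le_quadratic_nonpos) simp
  also have "\<dots> \<le> x + (1 + 9 * x\<^sup>2 / 16)"
    by simp
  also have "\<dots> \<le> x + exp (9 * x\<^sup>2 / 16)"
    using exp_ge_add_one_self[of "9 * x\<^sup>2 / 16"] by linarith
  finally show ?thesis .
next
  case False
  then have x: "x > 0" by simp
  show ?thesis
  proof (cases "x \<ge> 16 / 9")
    case True
    have "x * 1 \<le> x * (9 * x / 16)"
      using x True by (intro mult_left_mono) auto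
    then have "x \<le> 9 * x\<^sup>2 / 16"
      by (simp add: power2_eq_square)
    then show ?thesis
      using x by (smt (verit) exp_le_cancel_iff)
  next
    case False
    obtain t where t: "\<bar>t\<bar> \<le> \<bar>x\<bar>" "exp x = (\<Sum>m<6. x ^ m / fact m) + exp t / fact 6 * x ^ 6"
      using Maclaurin_exp_le[of x 6] by blast
    \<comment> \<open>Since \<open>t < 16/9 < 2\<close>, the remainder coefficient
      \<open>exp t / 720\<close> is at most \<open>9 / 720 = 1 / 80\<close>.\<close>
    have "exp t \<le> exp (1 + 1)"
      using t(1) x False by (subst exp_le_cancel_iff) linarith
    also have "\<dots> = exp 1 * exp 1"
      by (rule exp_add)
    also have "\<dots> \<le> 3 * (3 :: real)"
      by (intro mult_mono exp_le) auto
    finally have "exp t / 720 * x ^ 6 \<le> 9 / 720 * x ^ 6"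
      by (intro mult_right_mono divide_right_mono) auto
    then have up: "exp x \<le> 1 + x + x^2/2 + x^3/6 + x^4/24 + x^5/120 + x^6/80"
      using t(2) by (simp add: eval_nat_numeral field_simps)
    define y where "y = 9 * x\<^sup>2 / 16"
    obtain s where "exp y = (\<Sum>m<4. y ^ m / fact m) + exp s / fact 4 * y ^ 4"
      using Maclaurin_exp_le[of y 4] by blast
    moreover have "exp s / fact 4 * y ^ 4 \<ge> 0"
      by simp
    moreover have "(\<Sum>m<4. y ^ m / fact m) = 1 + y + y^2/2 + y^3/6"
      by (simp add: eval_nat_numeral)
    ultimately have low: "exp y \<ge> 1 + y + y^2/2 + y^3/6"
      by linarith
    \<comment> \<open>Divided by \<open>x^2\<close>, the difference of the two polynomials starts
      with \<open>1/16 - x/6\<close>, as does the square of \<open>1/4 - x/3 + x^2/100\<close>.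
      Subtracting that square leaves \<open>x^2\<close> times a quadratic with coefficients
      \<open>a\<close>, \<open>- b\<close>, \<open>c\<close>, which is nonnegative by its
      discriminant.\<close>
    define a b c :: real where "a = 81/512 - 1/24 - 1/9 - 1/200"
      and "b = 1/120 - 1/150" and "c = 243/8192 - 1/80 - 1/10000"
    have c: "c > 0" and disc: "b\<^sup>2 \<le> 4 * a * c"
      by (simp_all add: a_def b_def c_def power2_eq_square)
    have "0 \<le> (2 * c * x - b)\<^sup>2 + (4 * a * c - b\<^sup>2)"
      using disc by (intro add_nonneg_nonneg) auto
    also have "\<dots> = (4 * c) * (a - b * x + c * x\<^sup>2)"
      by (simp add: power2_eq_square algebra_simps)
    finally have q: "0 \<le> a - b * x + c * x\<^sup>2"
      using c by (simp add: zero_le_mult_iff)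
    have "0 \<le> x\<^sup>2 * ((1/4 - x/3 + x\<^sup>2/100)\<^sup>2 + x\<^sup>2 * (a - b * x + c * x\<^sup>2))"
      by (rule mult_nonneg_nonneg[OF zero_le_power2
            add_nonneg_nonneg[OF zero_le_power2 mult_nonneg_nonneg[OF zero_le_power2 q]]])
    also have "\<dots> = (x + (1 + y + y^2/2 + y^3/6)) - (1 + x + x^2/2 + x^3/6 + x^4/24 + x^5/120 + x^6/80)"
      by (simp add: y_def a_def b_def c_def eval_nat_numeral field_simps)
    finally show ?thesis
      using up low unfolding y_def by linarith
  qed
qed

lemma exp_le_quadratic: "exp x \<le> 1 + x + 2 * x\<^sup>2" if "x \<le> 1" for x :: real
proof (cases "x \<ge> 0")
  case True
  then show ?thesis using exp_bound[of x] that zero_le_power2[of x] by linarith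
next
  case False
  then have "exp x \<le> 1 + x + x\<^sup>2 / 2"
    by (intro exp_le_quadratic_nonpos) simp
  then show ?thesis
    using zero_le_power2[of x] by linarith
qed

text \<open>With \<open>x = exp y\<close> the right side is the tangent at \<open>x = exp 1\<close>
  of the concave power of \<open>x\<close> with exponent \<open>s\<close>. Its linearity in
  \<open>exp y\<close> turns a mean of \<open>exp Y\<close> bounded by \<open>exp 1\<close> into a
  mean of \<open>exp (s * Y)\<close> bounded by \<open>exp s\<close>.\<close>

lemma exp_mult_le_tangent: "exp (s * y) \<le> exp s * (1 - s) + s * exp s * exp (-1) * exp y"
  if "0 \<le> s" "s \<le> 1" for s y :: real
proof -
  have "exp (s * (y - 1)) \<le> (1 - s) * exp 0 + s * exp (y - 1)"
    using convex_onD[OF convex_on_exp[of 1], of s 0 "y - 1"] that by simp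
  then have "exp s * exp (s * (y - 1)) \<le> exp s * ((1 - s) + s * exp (y - 1))"
    by (intro mult_left_mono) auto
  also have "exp s * exp (s * (y - 1)) = exp (s * y)"
    by (simp add: exp_add[symmetric] algebra_simps)
  also have "exp (y - 1) = exp (-1) * exp y"
    by (simp add: exp_add[symmetric])
  finally show ?thesis by (simp add: algebra_simps)
qed

subsection \<open>Proximal steps\<close>

lemma norm_diff_convex_combination:
  fixes a b :: "'a::real_inner"
  shows "(norm ((1 - t) *\<^sub>R a + t *\<^sub>R b))\<^sup>2
    = (1 - t) * (norm a)\<^sup>2 + t * (norm b)\<^sup>2 - t * (1 - t) * (norm (b - a))\<^sup>2"
  by (simp add: power2_norm_eq_inner inner_add_left inner_add_right inner_diff_left
      inner_diff_right inner_commute[of b a] algebra_simps)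

text \<open>Comparing \<open>x'\<close> with the point at fraction \<open>t\<close> of the segment
  to \<open>z\<close> brings in the strong convexity term \<open>t * (1 - t) * d\<close>. Division
  by \<open>t\<close> leaves \<open>(1 - t) * d\<close>, and letting \<open>t\<close> tend to 0
  recovers all of \<open>d\<close>.\<close>

lemma prox_three_point:
  fixes x x' z :: "'a::real_inner"
  assumes "convex C" "convex_on C \<phi>" "x' \<in> C" "z \<in> C"
    and min: "\<And>y. y \<in> C \<Longrightarrow> \<phi> x' + a / 2 * (norm (x' - x))\<^sup>2 \<le> \<phi> y + a / 2 * (norm (y - x))\<^sup>2"
  shows "\<phi> x' + a / 2 * (norm (x' - x))\<^sup>2 + a / 2 * (norm (z - x'))\<^sup>2
           \<le> \<phi> z + a / 2 * (norm (z - x))\<^sup>2"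
proof -
  define d where "d = a / 2 * (norm (z - x'))\<^sup>2"
  define A where "A = \<phi> x' + a / 2 * (norm (x' - x))\<^sup>2"
  define B where "B = \<phi> z + a / 2 * (norm (z - x))\<^sup>2"
  have "u * d \<le> B - A" if u: "0 < u" "u < 1" for u
  proof -
    define t where "t = 1 - u"
    have t: "0 < t" "t < 1" using u by (auto simp: t_def)
    define y where "y = (1 - t) *\<^sub>R x' + t *\<^sub>R z"
    have y: "y \<in> C"
      unfolding y_def using assms t by (intro convexD_alt) auto
    have yx: "y - x = (1 - t) *\<^sub>R (x' - x) + t *\<^sub>R (z - x)"
      by (simp add: y_def algebra_simps)
    have "A \<le> \<phi> y + a / 2 * (norm (y - x))\<^sup>2"
      unfolding A_def by (rule min[OF y])
    also have "\<phi> y \<le> (1 - t) * \<phi> x' + t * \<phi> z"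
      unfolding y_def using assms t by (intro convex_onD) auto
    also have "(norm (y - x))\<^sup>2 = (1 - t) * (norm (x' - x))\<^sup>2 + t * (norm (z - x))\<^sup>2
        - t * (1 - t) * (norm (z - x'))\<^sup>2"
      unfolding yx by (subst norm_diff_convex_combination) simp
    finally have "A \<le> (1 - t) * A + t * B - t * (1 - t) * d"
      by (simp add: A_def B_def d_def algebra_simps add_divide_distrib diff_divide_distrib)
    then have "t * (u * d) \<le> t * (B - A)"
      by (simp add: t_def algebra_simps)
    then show ?thesis using t by simp
  qed
  then have "d \<le> B - A"
    by (rule field_le_mult_one_interval)
  then show ?thesis by (simp add: A_def B_def d_def)
qed

lemma arg_min_on_compact:
  fixes h :: "'a::topological_space \<Rightarrow> real"
  assumes "compact C" "C \<noteq> {}" "continuous_on C h"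
  shows "arg_min_on h C \<in> C" "\<And>y. y \<in> C \<Longrightarrow> h (arg_min_on h C) \<le> h y"
proof -
  obtain x where "x \<in> C" "\<forall>y\<in>C. h x \<le> h y"
    using continuous_attains_inf[OF assms] by blast
  then have "is_arg_min h (\<lambda>x. x \<in> C) x"
    by (auto simp: is_arg_min_linorder)
  then have "is_arg_min h (\<lambda>x. x \<in> C) (arg_min_on h C)"
    unfolding arg_min_on_def arg_min_def by (rule someI)
  then show "arg_min_on h C \<in> C" "\<And>y. y \<in> C \<Longrightarrow> h (arg_min_on h C) \<le> h y"
    by (auto simp: is_arg_min_linorder)
qed

text \<open>By uniqueness, \<open>X w\<close> lies in the compact set \<open>C - S\<close> exactly
  when that set is nonempty and the minimum of \<open>h w\<close> over it does not exceed the
  minimum over \<open>C\<close>. Continuity allows both minima to be computed on countable dense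
  subsets.\<close>

lemma measurable_unique_minimizer:
  fixes h :: "'w \<Rightarrow> 'a::euclidean_space \<Rightarrow> real"
  assumes C: "compact C"
    and cont: "\<And>w. w \<in> space N \<Longrightarrow> continuous_on C (h w)"
    and meas: "\<And>y. y \<in> C \<Longrightarrow> (\<lambda>w. h w y) \<in> borel_measurable N"
    and X: "\<And>w. w \<in> space N \<Longrightarrow> X w \<in> C"
    and min: "\<And>w y. w \<in> space N \<Longrightarrow> y \<in> C \<Longrightarrow> h w (X w) \<le> h w y"
    and uniq: "\<And>w y. w \<in> space N \<Longrightarrow> y \<in> C \<Longrightarrow> h w y \<le> h w (X w) \<Longrightarrow> y = X w"
  shows "X \<in> borel_measurable N"
proof (rule borel_measurableI)
  fix S :: "'a set" assume "open S"
  define A where "A = C - S"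
  have A: "compact A" "A \<subseteq> C"
    using C \<open>open S\<close> by (auto simp: A_def compact_diff)
  obtain D where D: "countable D" "D \<subseteq> C" "C \<subseteq> closure D"
    using separable[of C] by blast
  obtain E where E: "countable E" "E \<subseteq> A" "A \<subseteq> closure E"
    using separable[of A] by blast
  have approx: "\<exists>y\<in>T. h w y < h w x + e"
    if w: "w \<in> space N" and T: "T \<subseteq> C" "x \<in> closure T" "x \<in> C" and e: "e > 0" for w x T and e :: real
  proof -
    obtain d where d: "d > 0" "\<And>y. y \<in> C \<Longrightarrow> dist y x < d \<Longrightarrow> dist (h w y) (h w x) < e"
      using cont[OF w] T(3) e unfolding continuous_on_iff by blast
    obtain y where "y \<in> T" "dist y x < d"
      using T(2) d(1) unfolding closure_approachable by blast
    with d(2)[of y] T(1) show ?thesis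
      by (auto simp: dist_real_def intro!: bexI[of _ y])
  qed
  \<comment> \<open>The slack \<open>1 / (n + 1)\<close> is there because a minimum over
    \<open>A\<close> need not be attained in the dense set \<open>E\<close>; compactness of
    \<open>A\<close> supplies the actual minimizer.\<close>
  have eq: "X -` S \<inter> space N = space N - (\<Inter>d\<in>D. \<Inter>n. \<Union>a\<in>E. {w \<in> space N. h w a < h w d + 1 / real (Suc n)})"
  proof (intro equalityI subsetI)
    fix w assume w: "w \<in> X -` S \<inter> space N"
    show "w \<in> space N - (\<Inter>d\<in>D. \<Inter>n. \<Union>a\<in>E. {w \<in> space N. h w a < h w d + 1 / real (Suc n)})"
    proof (rule ccontr)
      assume "\<not> ?thesis"
      with w have *: "\<And>d n. d \<in> D \<Longrightarrow> \<exists>a\<in>E. h w a < h w d + 1 / real (Suc n)"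
        by blast
      have "D \<noteq> {}"
        using D X[of w] w by auto
      with * have "A \<noteq> {}"
        using E by blast
      then obtain a where a: "a \<in> A" "\<And>y. y \<in> A \<Longrightarrow> h w a \<le> h w y"
        using continuous_attains_inf[OF A(1), of "h w"] continuous_on_subset[OF cont A(2)] w by blast
      have "h w a \<le> h w (X w) + e" if "e > 0" for e
      proof -
        obtain d where d: "d \<in> D" "h w d < h w (X w) + e / 2"
          using approx[of w D "X w" "e / 2"] D w X[of w] \<open>e > 0\<close> by auto
        obtain n where "1 / real (Suc n) < e / 2"
          using nat_approx_posE[of "e / 2"] \<open>e > 0\<close> by auto
        moreover obtain a' where "a' \<in> E" "h w a' < h w d + 1 / real (Suc n)"
          using *[OF d(1)] by blast
        moreover have "h w a \<le> h w a'"
          using a(2) \<open>a' \<in> E\<close> E by blast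
        ultimately show ?thesis using d(2) by linarith
      qed
      then have "h w a \<le> h w (X w)"
        by (rule field_le_epsilon)
      then have "a = X w"
        using uniq[of w a] a A w by blast
      with a w show False by (auto simp: A_def)
    qed
  next
    fix w assume w: "w \<in> space N - (\<Inter>d\<in>D. \<Inter>n. \<Union>a\<in>E. {w \<in> space N. h w a < h w d + 1 / real (Suc n)})"
    have "X w \<in> S"
    proof (rule ccontr)
      assume "X w \<notin> S"
      then have XA: "X w \<in> A" using X w by (auto simp: A_def)
      obtain d n where d: "d \<in> D" "\<not> (\<exists>a\<in>E. h w a < h w d + 1 / real (Suc n))"
        using w by blast
      obtain a where "a \<in> E" "h w a < h w (X w) + 1 / real (Suc n)"
        using approx[of w E "X w" "1 / real (Suc n)"] E A XA w by auto
      moreover have "h w (X w) \<le> h w d"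
        using min[of w d] d w D by auto
      ultimately show False using d(2) by force
    qed
    with w show "w \<in> X -` S \<inter> space N" by auto
  qed
  have [measurable]: "\<And>y. y \<in> D \<Longrightarrow> (\<lambda>w. h w y) \<in> borel_measurable N"
      "\<And>y. y \<in> E \<Longrightarrow> (\<lambda>w. h w y) \<in> borel_measurable N"
    using meas D E A by auto
  \<comment> \<open>The countable intersection over \<open>D\<close> needs a nonempty index set; an
    empty \<open>D\<close> leaves no value for \<open>X\<close>, so the whole space is
    empty.\<close>
  have "D = {} \<Longrightarrow> space N = {}"
    using D X by auto
  then show "X -` S \<inter> space N \<in> sets N"
    unfolding eq using D(1) E(1)
    by (cases "D = {}") (auto intro!: sets.Diff sets.countable_INT' sets.countable_INT sets.countable_UN' sets.countable_UN'')
qed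

subsection \<open>Histories of an i.i.d. sequence\<close>

locale iid_sequence = prob_space +
  fixes S :: "'q measure" and \<xi> :: "nat \<Rightarrow> 'a \<Rightarrow> 'q" and \<mu> :: "'q measure"
  assumes indep: "indep_vars (\<lambda>_. S) \<xi> UNIV"
    and law: "\<And>k. distr M S (\<xi> k) = \<mu>"
begin

lemma \<xi>_measurable [measurable]: "\<xi> k \<in> M \<rightarrow>\<^sub>M S"
  using indep by (simp add: indep_vars_def)

lemma sets_\<mu> [measurable_cong, simp]: "sets \<mu> = sets S"
  by (simp add: law[of 0, symmetric])

lemma space_\<mu> [simp]: "space \<mu> = space S"
  by (simp add: law[of 0, symmetric])

lemma prob_space_\<mu>: "prob_space \<mu>"
  unfolding law[of 0, symmetric] by (rule prob_space_distr) simp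

text \<open>Sample \<open>k\<close> is excluded, so it stays fresh relative to the state at time
  \<open>k\<close>. The pullback from a product space matches independence of disjoint index
  blocks.\<close>

definition hist :: "nat \<Rightarrow> 'a measure" where
  "hist k = vimage_algebra (space M) (\<lambda>\<omega>. restrict (\<lambda>j. \<xi> j \<omega>) {..<k}) (PiM {..<k} (\<lambda>_. S))"

lemma space_hist [simp]: "space (hist k) = space M"
  by (simp add: hist_def)

lemma restrict_\<xi>_measurable [measurable]:
  "(\<lambda>\<omega>. restrict (\<lambda>j. \<xi> j \<omega>) A) \<in> M \<rightarrow>\<^sub>M PiM A (\<lambda>_. S)"
  by (intro measurable_restrict) simp

lemma \<xi>_measurable_hist: "\<xi> j \<in> hist k \<rightarrow>\<^sub>M S" if "j < k"
proof -
  have "(\<lambda>\<omega>. restrict (\<lambda>j. \<xi> j \<omega>) {..<k}) \<in> hist k \<rightarrow>\<^sub>M PiM {..<k} (\<lambda>_. S)"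
    unfolding hist_def
    by (intro measurable_vimage_algebra1 Pi_I measurable_space[OF restrict_\<xi>_measurable])
  then have "(\<lambda>\<omega>. restrict (\<lambda>j. \<xi> j \<omega>) {..<k} j) \<in> hist k \<rightarrow>\<^sub>M S"
    by (rule measurable_compose) (use that in \<open>auto intro!: measurable_component_singleton\<close>)
  then show ?thesis using that by simp
qed

lemma hist_leI:
  assumes "space N = space M" "\<And>j. j < k \<Longrightarrow> \<xi> j \<in> N \<rightarrow>\<^sub>M S"
  shows "sets (hist k) \<subseteq> sets N"
proof -
  have "(\<lambda>\<omega>. restrict (\<lambda>j. \<xi> j \<omega>) {..<k}) \<in> N \<rightarrow>\<^sub>M PiM {..<k} (\<lambda>_. S)"
    using assms by (intro measurable_restrict) auto
  from measurable_sets[OF this] assms(1) show ?thesis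
    by (subst hist_def, subst sets_vimage_algebra2)
       (auto intro!: measurable_space[OF restrict_\<xi>_measurable])
qed

lemma measurable_hist_mono: "f \<in> hist k \<rightarrow>\<^sub>M N \<Longrightarrow> k \<le> l \<Longrightarrow> f \<in> hist l \<rightarrow>\<^sub>M N"
  by (rule measurable_from_subalg[of "hist l" "hist k"])
     (simp_all add: subalgebra_def hist_leI \<xi>_measurable_hist)

lemma measurable_hist: "f \<in> hist k \<rightarrow>\<^sub>M N \<Longrightarrow> f \<in> M \<rightarrow>\<^sub>M N"
  by (rule measurable_from_subalg[of M "hist k"]) (simp_all add: subalgebra_def hist_leI)

lemma emeasure_hist:
  assumes A: "A \<in> sets (hist k)" and B: "B \<in> sets S"
  shows "emeasure M (A \<inter> (\<xi> k -` B \<inter> space M)) = emeasure M A * emeasure M (\<xi> k -` B \<inter> space M)"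
proof -
  let ?P = "\<lambda>A. PiM A (\<lambda>_. S)" and ?X = "\<lambda>A \<omega>. restrict (\<lambda>j. \<xi> j \<omega>) A"
  have "?X {..<k} \<in> space M \<rightarrow> space (?P {..<k})"
    by (intro Pi_I measurable_space[OF restrict_\<xi>_measurable])
  then obtain A' where A': "A' \<in> sets (?P {..<k})" "A = ?X {..<k} -` A' \<inter> space M"
    using A unfolding hist_def sets_vimage_algebra2[OF \<open>?X {..<k} \<in> _ \<rightarrow> _\<close>] by blast
  define B' where "B' = {x \<in> space (?P {k}). x k \<in> B}"
  have B': "B' \<in> sets (?P {k})"
    unfolding B'_def using B by measurable
  have B_eq: "?X {k} -` B' \<inter> space M = \<xi> k -` B \<inter> space M"
    by (auto simp: B'_def space_PiM intro: measurable_space[OF \<xi>_measurable])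
  have "indep_var (?P {..<k}) (?X {..<k}) (?P {k}) (?X {k})"
    by (intro indep_var_restrict[OF indep]) auto
  moreover have "(\<lambda>\<omega>. (?X {..<k} \<omega>, ?X {k} \<omega>)) -` (A' \<times> B') \<inter> space M = A \<inter> (\<xi> k -` B \<inter> space M)"
    unfolding A'(2) B_eq[symmetric] by blast
  ultimately have "prob (A \<inter> (\<xi> k -` B \<inter> space M))
      = prob A * prob (\<xi> k -` B \<inter> space M)"
    using indep_varD[of "?P {..<k}" "?X {..<k}" "?P {k}" "?X {k}", OF _ A'(1) B']
    by (simp only: A'(2) B_eq)
  then show ?thesis
    by (simp add: emeasure_eq_measure ennreal_mult)
qed

text \<open>The identity, viewed as a map into the coarser space \<open>hist k\<close>, is
  independent of \<open>\<xi> k\<close>. With this product law, Fubini does the work of conditioning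
  on the history.\<close>

lemma distr_hist_pair:
  "distr M (hist k \<Otimes>\<^sub>M S) (\<lambda>\<omega>. (\<omega>, \<xi> k \<omega>)) = distr M (hist k) (\<lambda>\<omega>. \<omega>) \<Otimes>\<^sub>M \<mu>"
proof -
  have id [measurable]: "(\<lambda>\<omega>. \<omega>) \<in> M \<rightarrow>\<^sub>M hist k"
    by (rule measurable_hist[of _ k]) simp
  interpret \<mu>: prob_space \<mu> by (rule prob_space_\<mu>)
  interpret D: prob_space "distr M (hist k) (\<lambda>\<omega>. \<omega>)" by (rule prob_space_distr) simp
  show ?thesis
  proof (rule pair_measure_eqI[symmetric])
    fix A B assume "A \<in> sets (distr M (hist k) (\<lambda>\<omega>. \<omega>))" "B \<in> sets \<mu>"
    then have A [measurable]: "A \<in> sets (hist k)" and B [measurable]: "B \<in> sets S" by auto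
    have "(\<lambda>\<omega>. (\<omega>, \<xi> k \<omega>)) -` (A \<times> B) \<inter> space M = A \<inter> (\<xi> k -` B \<inter> space M)"
      using sets.sets_into_space[OF A] by auto
    moreover have "(\<lambda>\<omega>. \<omega>) -` A \<inter> space M = A"
      using sets.sets_into_space[OF A] by auto
    ultimately show "emeasure (distr M (hist k) (\<lambda>\<omega>. \<omega>)) A * emeasure \<mu> B
        = emeasure (distr M (hist k \<Otimes>\<^sub>M S) (\<lambda>\<omega>. (\<omega>, \<xi> k \<omega>))) (A \<times> B)"
      by (subst law[of k, symmetric]) (simp add: emeasure_distr emeasure_hist)
  qed (auto intro: \<mu>.sigma_finite_measure_axioms D.sigma_finite_measure_axioms cong: sets_pair_measure_cong)
qed

lemma nn_integral_hist:
  assumes [measurable]: "(\<lambda>(\<omega>, z). h \<omega> z) \<in> borel_measurable (hist k \<Otimes>\<^sub>M S)"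
  shows "(\<integral>\<^sup>+\<omega>. h \<omega> (\<xi> k \<omega>) \<partial>M) = (\<integral>\<^sup>+\<omega>. (\<integral>\<^sup>+z. h \<omega> z \<partial>\<mu>) \<partial>M)"
proof -
  have id [measurable]: "(\<lambda>\<omega>. \<omega>) \<in> M \<rightarrow>\<^sub>M hist k"
    by (rule measurable_hist[of _ k]) simp
  interpret \<mu>: prob_space \<mu> by (rule prob_space_\<mu>)
  have "(\<integral>\<^sup>+\<omega>. h \<omega> (\<xi> k \<omega>) \<partial>M) = (\<integral>\<^sup>+\<omega>. (\<lambda>(\<omega>, z). h \<omega> z) (\<omega>, \<xi> k \<omega>) \<partial>M)"
    by simp
  also have "\<dots> = (\<integral>\<^sup>+x. (\<lambda>(\<omega>, z). h \<omega> z) x \<partial>distr M (hist k \<Otimes>\<^sub>M S) (\<lambda>\<omega>. (\<omega>, \<xi> k \<omega>)))"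
    by (subst nn_integral_distr) auto
  also have "distr M (hist k \<Otimes>\<^sub>M S) (\<lambda>\<omega>. (\<omega>, \<xi> k \<omega>)) = distr M (hist k) (\<lambda>\<omega>. \<omega>) \<Otimes>\<^sub>M \<mu>"
    by (rule distr_hist_pair)
  also have "(\<integral>\<^sup>+x. (\<lambda>(\<omega>, z). h \<omega> z) x \<partial>(distr M (hist k) (\<lambda>\<omega>. \<omega>) \<Otimes>\<^sub>M \<mu>))
      = (\<integral>\<^sup>+\<omega>. (\<integral>\<^sup>+z. h \<omega> z \<partial>\<mu>) \<partial>distr M (hist k) (\<lambda>\<omega>. \<omega>))"
    by (subst \<mu>.nn_integral_fst[symmetric]) auto
  also have "\<dots> = (\<integral>\<^sup>+\<omega>. (\<integral>\<^sup>+z. h \<omega> z \<partial>\<mu>) \<partial>M)"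
    by (subst nn_integral_distr) auto
  finally show ?thesis .
qed

text \<open>A signed counterpart of freezing the history, restricted to products, where independence
  supplies integrability and factorization together.\<close>

lemma integral_hist_mult:
  fixes H :: "'q \<Rightarrow> real"
  assumes Y: "Y \<in> borel_measurable (hist k)" "integrable M Y" and H: "integrable \<mu> H"
  shows "integrable M (\<lambda>\<omega>. Y \<omega> * H (\<xi> k \<omega>))"
    and "(\<integral>\<omega>. Y \<omega> * H (\<xi> k \<omega>) \<partial>M) = (\<integral>\<omega>. Y \<omega> \<partial>M) * (\<integral>z. H z \<partial>\<mu>)"
proof -
  have Hm [measurable]: "H \<in> borel_measurable S"
    using H by auto
  have Ym [measurable]: "Y \<in> borel_measurable M"
    using Y(2) by auto
  have ind: "indep_var borel Y borel (\<lambda>\<omega>. H (\<xi> k \<omega>))"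
    unfolding indep_var_distribution_eq
  proof (intro conjI pair_measure_eqI)
    fix A B assume "A \<in> sets (distr M borel Y)" "B \<in> sets (distr M borel (\<lambda>\<omega>. H (\<xi> k \<omega>)))"
    then have A [measurable]: "A \<in> sets borel" and B [measurable]: "B \<in> sets borel" by auto
    have YA: "Y -` A \<inter> space M \<in> sets (hist k)"
      using measurable_sets[OF Y(1) A] by simp
    have HB: "H -` B \<inter> space S \<in> sets S" by measurable
    have "(\<lambda>\<omega>. H (\<xi> k \<omega>)) -` B \<inter> space M = \<xi> k -` (H -` B \<inter> space S) \<inter> space M"
      by (auto intro: measurable_space[OF \<xi>_measurable])
    moreover have "(\<lambda>\<omega>. (Y \<omega>, H (\<xi> k \<omega>))) -` (A \<times> B) \<inter> space M
        = (Y -` A \<inter> space M) \<inter> (\<xi> k -` (H -` B \<inter> space S) \<inter> space M)"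
      by (auto intro: measurable_space[OF \<xi>_measurable])
    ultimately have "emeasure M (Y -` A \<inter> space M) * emeasure M ((\<lambda>\<omega>. H (\<xi> k \<omega>)) -` B \<inter> space M)
        = emeasure M ((\<lambda>\<omega>. (Y \<omega>, H (\<xi> k \<omega>))) -` (A \<times> B) \<inter> space M)"
      using emeasure_hist[OF YA HB] by (simp only:)
    then show "emeasure (distr M borel Y) A * emeasure (distr M borel (\<lambda>\<omega>. H (\<xi> k \<omega>))) B
        = emeasure (distr M (borel \<Otimes>\<^sub>M borel) (\<lambda>\<omega>. (Y \<omega>, H (\<xi> k \<omega>)))) (A \<times> B)"
      by (simp add: emeasure_distr)
  qed (auto intro!: prob_space_imp_sigma_finite prob_space_distr cong: sets_pair_measure_cong)
  have int: "integrable M (\<lambda>\<omega>. H (\<xi> k \<omega>))"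
    using H unfolding law[of k, symmetric] by (subst (asm) integrable_distr_eq) auto
  show "integrable M (\<lambda>\<omega>. Y \<omega> * H (\<xi> k \<omega>))"
    by (rule indep_var_integrable[OF ind Y(2) int])
  have "(\<integral>\<omega>. H (\<xi> k \<omega>) \<partial>M) = (\<integral>z. H z \<partial>\<mu>)"
    unfolding law[of k, symmetric] by (subst integral_distr) auto
  then show "(\<integral>\<omega>. Y \<omega> * H (\<xi> k \<omega>) \<partial>M) = (\<integral>\<omega>. Y \<omega> \<partial>M) * (\<integral>z. H z \<partial>\<mu>)"
    using indep_var_lebesgue_integral[OF ind Y(2) int] by simp
qed

lemma AE_\<xi>: "AE z in \<mu>. P z \<Longrightarrow> AE \<omega> in M. \<forall>k. P (\<xi> k \<omega>)"
  unfolding AE_all_countable by (metis AE_distrD law \<xi>_measurable)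

text \<open>Peel off the last summand: the earlier ones are measurable in \<open>hist n\<close>, so
  integrating over the newest sample alone contributes one factor \<open>exp c\<close>.\<close>

lemma nn_integral_exp_sum_le:
  fixes h :: "nat \<Rightarrow> 'a \<Rightarrow> 'q \<Rightarrow> real"
  assumes h: "\<And>k. k < n \<Longrightarrow> (\<lambda>(\<omega>, z). h k \<omega> z) \<in> borel_measurable (hist k \<Otimes>\<^sub>M S)"
    and c: "\<And>k \<omega>. k < n \<Longrightarrow> \<omega> \<in> space M \<Longrightarrow> (\<integral>\<^sup>+z. ennreal (exp (h k \<omega> z)) \<partial>\<mu>) \<le> ennreal (exp c)"
  shows "(\<integral>\<^sup>+\<omega>. ennreal (exp (\<Sum>k<n. h k \<omega> (\<xi> k \<omega>))) \<partial>M) \<le> ennreal (exp (real n * c))"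
  using assms
proof (induction n)
  case 0
  then show ?case by (simp add: emeasure_space_1)
next
  case (Suc n)
  have [measurable]: "(\<lambda>(\<omega>, z). h n \<omega> z) \<in> borel_measurable (hist n \<Otimes>\<^sub>M S)"
    using Suc.prems(1) by simp
  have prev: "(\<lambda>\<omega>. \<Sum>k<n. h k \<omega> (\<xi> k \<omega>)) \<in> borel_measurable (hist n)"
  proof (rule borel_measurable_sum)
    fix k assume "k \<in> {..<n}"
    then have k: "k < n" by simp
    have "(\<lambda>\<omega>. \<omega>) \<in> hist n \<rightarrow>\<^sub>M hist k"
      by (rule measurable_hist_mono[of _ k]) (use k in auto)
    then have "(\<lambda>\<omega>. (\<omega>, \<xi> k \<omega>)) \<in> hist n \<rightarrow>\<^sub>M hist k \<Otimes>\<^sub>M S"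
      using \<xi>_measurable_hist[OF k] by simp
    from measurable_compose[OF this Suc.prems(1)[of k]] k
    show "(\<lambda>\<omega>. h k \<omega> (\<xi> k \<omega>)) \<in> borel_measurable (hist n)" by simp
  qed
  note [measurable] = prev measurable_hist[OF prev]
  let ?T = "\<lambda>\<omega>. \<Sum>k<n. h k \<omega> (\<xi> k \<omega>)"
  have "(\<integral>\<^sup>+\<omega>. ennreal (exp (\<Sum>k<Suc n. h k \<omega> (\<xi> k \<omega>))) \<partial>M)
      = (\<integral>\<^sup>+\<omega>. ennreal (exp (?T \<omega>) * exp (h n \<omega> (\<xi> n \<omega>))) \<partial>M)"
    by (simp add: exp_add)
  also have "\<dots> = (\<integral>\<^sup>+\<omega>. (\<integral>\<^sup>+z. ennreal (exp (?T \<omega>) * exp (h n \<omega> z)) \<partial>\<mu>) \<partial>M)"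
    by (rule nn_integral_hist) measurable
  also have "\<dots> = (\<integral>\<^sup>+\<omega>. ennreal (exp (?T \<omega>)) * (\<integral>\<^sup>+z. ennreal (exp (h n \<omega> z)) \<partial>\<mu>) \<partial>M)"
  proof (rule nn_integral_cong)
    fix \<omega> assume "\<omega> \<in> space M"
    then have [measurable]: "h n \<omega> \<in> borel_measurable S"
      using measurable_Pair2[of "\<lambda>(\<omega>, z). h n \<omega> z" "hist n" S borel \<omega>] by simp
    show "(\<integral>\<^sup>+z. ennreal (exp (?T \<omega>) * exp (h n \<omega> z)) \<partial>\<mu>)
        = ennreal (exp (?T \<omega>)) * (\<integral>\<^sup>+z. ennreal (exp (h n \<omega> z)) \<partial>\<mu>)"
      by (subst nn_integral_cmult[symmetric]) (auto simp: ennreal_mult)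
  qed
  also have "\<dots> \<le> (\<integral>\<^sup>+\<omega>. ennreal (exp (?T \<omega>)) * ennreal (exp c) \<partial>M)"
    by (intro nn_integral_mono mult_left_mono Suc.prems) auto
  also have "\<dots> = (\<integral>\<^sup>+\<omega>. ennreal (exp (?T \<omega>)) \<partial>M) * ennreal (exp c)"
    by (rule nn_integral_multc) measurable
  also have "\<dots> \<le> ennreal (exp (real n * c)) * ennreal (exp c)"
    by (intro mult_right_mono Suc.IH Suc.prems) auto
  also have "\<dots> = ennreal (exp (real (Suc n) * c))"
    by (simp add: ennreal_mult[symmetric] exp_add[symmetric] algebra_simps)
  finally show ?case .
qed

end

lemma (in prob_space) prob_Chernoff:
  assumes [measurable]: "X \<in> borel_measurable M"
    and "(\<integral>\<^sup>+\<omega>. ennreal (exp (t * X \<omega>)) \<partial>M) \<le> ennreal b" "t > 0" "b \<ge> 0"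
  shows "prob {\<omega> \<in> space M. X \<omega> \<ge> a} \<le> exp (- t * a) * b"
proof -
  have "emeasure M {\<omega> \<in> space M. X \<omega> \<ge> a}
      \<le> ennreal (exp (- t * a)) * (\<integral>\<^sup>+\<omega>. ennreal (exp (t * X \<omega>)) * indicator (space M) \<omega> \<partial>M)"
    using Chernoff_ineq_nn_integral_ge[of t "space M" M X a] assms by simp
  also have "(\<integral>\<^sup>+\<omega>. ennreal (exp (t * X \<omega>)) * indicator (space M) \<omega> \<partial>M)
      = (\<integral>\<^sup>+\<omega>. ennreal (exp (t * X \<omega>)) \<partial>M)"
    by (intro nn_integral_cong) auto
  also have "ennreal (exp (- t * a)) * \<dots> \<le> ennreal (exp (- t * a)) * ennreal b"
    by (intro mult_left_mono assms) auto
  finally show ?thesis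
    using assms by (simp add: emeasure_eq_measure ennreal_mult[symmetric])
qed

subsection \<open>Exponential moments of bounded and sub-Gaussian variables\<close>

text \<open>For small \<open>t\<close> the inequality \<open>e\<^sup>x \<le> x + e^(9x\<^sup>2/16)\<close> removes the linear term; for large \<open>t\<close>
  Young's inequality for \<open>t X\<close> suffices.\<close>
lemma (in prob_space) nn_integral_exp_subgaussian:
  fixes X :: "'a \<Rightarrow> real"
  assumes X: "integrable M X" "expectation X = 0" and s: "s > 0"
    and e: "(\<integral>\<^sup>+\<omega>. ennreal (exp (\<bar>X \<omega>\<bar>\<^sup>2 / s\<^sup>2)) \<partial>M) \<le> ennreal (exp 1)"
  shows "(\<integral>\<^sup>+\<omega>. ennreal (exp (t * X \<omega>)) \<partial>M) \<le> ennreal (exp (3 / 4 * t\<^sup>2 * s\<^sup>2))"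
proof -
  note [measurable] = borel_measurable_integrable[OF X(1)]
  define Y where "Y = (\<lambda>\<omega>. (X \<omega>)\<^sup>2 / s\<^sup>2)"
  have [measurable]: "Y \<in> borel_measurable M" unfolding Y_def by measurable
  have intY: "integrable M (\<lambda>\<omega>. exp (Y \<omega>))"
  proof (rule integrableI_bounded)
    have "(\<integral>\<^sup>+\<omega>. ennreal (norm (exp (Y \<omega>))) \<partial>M) \<le> ennreal (exp 1)"
      using e by (simp add: Y_def)
    then show "(\<integral>\<^sup>+\<omega>. ennreal (norm (exp (Y \<omega>))) \<partial>M) < \<infinity>"
      using le_less_trans by fastforce
  qed measurable
  have EY: "expectation (\<lambda>\<omega>. exp (Y \<omega>)) \<le> exp 1"
    using e unfolding Y_def[symmetric]
    by (intro integral_real_bounded) (auto simp: Y_def)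
  have Ey: "expectation (\<lambda>\<omega>. exp u * (1 - u) + u * exp u * exp (-1) * exp (Y \<omega>)) \<le> exp u"
    if "u \<ge> 0" for u
  proof -
    have "expectation (\<lambda>\<omega>. exp u * (1 - u) + u * exp u * exp (-1) * exp (Y \<omega>))
        = exp u * (1 - u) + u * exp u * exp (-1) * expectation (\<lambda>\<omega>. exp (Y \<omega>))"
      using intY by (simp add: prob_space)
    also have "\<dots> \<le> exp u * (1 - u) + u * exp u * exp (-1) * exp 1"
      using EY that by (intro add_mono mult_left_mono) auto
    also have "\<dots> = exp u * (1 - u) + u * exp u * (exp (-1) * exp 1)"
      by simp
    also have "exp (-1) * exp 1 = (1 :: real)"
      by (simp add: exp_add[symmetric])
    finally show ?thesis by (simp add: algebra_simps)
  qed
  \<comment> \<open>The case split is exactly \<open>u \<le> 1\<close> for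
    \<open>u = 9 * (t * s)^2 / 16\<close>, the range in which the tangent bound applies.\<close>
  show ?thesis
  proof (cases "9 * (t * s)\<^sup>2 \<le> 16")
    case True
    define u where "u = 9 * (t * s)\<^sup>2 / 16"
    have u: "0 \<le> u" "u \<le> 1" using True by (auto simp: u_def)
    let ?b = "\<lambda>\<omega>. t * X \<omega> + (exp u * (1 - u) + u * exp u * exp (-1) * exp (Y \<omega>))"
    have le: "exp (t * X \<omega>) \<le> ?b \<omega>" for \<omega>
    proof -
      have "exp (t * X \<omega>) \<le> t * X \<omega> + exp (9 * (t * X \<omega>)\<^sup>2 / 16)"
        by (rule exp_le_add_exp_square)
      also have "9 * (t * X \<omega>)\<^sup>2 / 16 = u * Y \<omega>"
        using s by (simp add: u_def Y_def power_mult_distrib)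
      also have "exp (u * Y \<omega>) \<le> exp u * (1 - u) + u * exp u * exp (-1) * exp (Y \<omega>)"
        by (rule exp_mult_le_tangent[OF u])
      finally show ?thesis by simp
    qed
    have "(\<integral>\<^sup>+\<omega>. ennreal (exp (t * X \<omega>)) \<partial>M) \<le> (\<integral>\<^sup>+\<omega>. ennreal (?b \<omega>) \<partial>M)"
      by (intro nn_integral_mono ennreal_leI le)
    also have "\<dots> = ennreal (expectation ?b)"
    proof (rule nn_integral_eq_integral)
      show "integrable M ?b" using X intY by simp
      have "0 \<le> ?b \<omega>" for \<omega>
        using le[of \<omega>] exp_ge_zero[of "t * X \<omega>"] by linarith
      then show "AE \<omega> in M. 0 \<le> ?b \<omega>" by simp
    qed
    also have "expectation ?b = expectation (\<lambda>\<omega>. t * X \<omega>)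
        + expectation (\<lambda>\<omega>. exp u * (1 - u) + u * exp u * exp (-1) * exp (Y \<omega>))"
      using X intY by (intro Bochner_Integration.integral_add) auto
    also have "\<dots> \<le> 0 + exp u"
      using X Ey[OF u(1)] by (intro add_mono) auto
    also have "\<dots> \<le> exp (3 / 4 * t\<^sup>2 * s\<^sup>2)"
      by (simp add: u_def power_mult_distrib)
    finally show ?thesis by (simp add: ennreal_leI)
  next
    case False
    \<comment> \<open>Young's inequality from \<open>(3 * A - 4 * B)^2 \<ge> 0\<close> produces the
      weights \<open>3/8\<close> and \<open>2/3\<close>. The extra constant \<open>2/3\<close> is
      absorbed by another \<open>3/8 * (t * s)^2\<close> precisely when
      \<open>(t * s)^2 \<ge> 16/9\<close>, which is this case.\<close>
    define u :: real where "u = 2 / 3"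
    let ?b = "\<lambda>\<omega>. exp (3 * (t * s)\<^sup>2 / 8) * (exp u * (1 - u) + u * exp u * exp (-1) * exp (Y \<omega>))"
    have le: "exp (t * X \<omega>) \<le> ?b \<omega>" for \<omega>
    proof -
      define A B where "A = t * s" and "B = X \<omega> / s"
      have "0 \<le> (3 * A - 4 * B)\<^sup>2" by simp
      then have "A * B \<le> 3 * A\<^sup>2 / 8 + u * B\<^sup>2"
        by (simp add: u_def power2_eq_square algebra_simps)
      moreover have "A * B = t * X \<omega>" "B\<^sup>2 = Y \<omega>"
        using s by (auto simp: A_def B_def Y_def power_divide)
      ultimately have "exp (t * X \<omega>) \<le> exp (3 * A\<^sup>2 / 8 + u * Y \<omega>)"
        by simp
      also have "\<dots> = exp (3 * A\<^sup>2 / 8) * exp (u * Y \<omega>)"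
        by (rule exp_add)
      also have "\<dots> \<le> ?b \<omega>"
        unfolding A_def by (intro mult_left_mono exp_mult_le_tangent) (auto simp: u_def)
      finally show ?thesis .
    qed
    have "(\<integral>\<^sup>+\<omega>. ennreal (exp (t * X \<omega>)) \<partial>M) \<le> (\<integral>\<^sup>+\<omega>. ennreal (?b \<omega>) \<partial>M)"
      by (intro nn_integral_mono ennreal_leI le)
    also have "\<dots> = ennreal (expectation ?b)"
    proof (rule nn_integral_eq_integral)
      show "integrable M ?b" using intY by simp
      have "0 \<le> ?b \<omega>" for \<omega>
        using le[of \<omega>] exp_ge_zero[of "t * X \<omega>"] by linarith
      then show "AE \<omega> in M. 0 \<le> ?b \<omega>" by simp
    qed
    also have "expectation ?b = exp (3 * (t * s)\<^sup>2 / 8)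
        * expectation (\<lambda>\<omega>. exp u * (1 - u) + u * exp u * exp (-1) * exp (Y \<omega>))"
      by simp
    also have "\<dots> \<le> exp (3 * (t * s)\<^sup>2 / 8) * exp u"
      by (intro mult_left_mono Ey) (auto simp: u_def)
    also have "\<dots> = exp (3 * (t * s)\<^sup>2 / 8 + u)"
      by (rule exp_add[symmetric])
    also have "\<dots> \<le> exp (3 / 4 * t\<^sup>2 * s\<^sup>2)"
      using False unfolding exp_le_cancel_iff u_def power_mult_distrib by argo
    finally show ?thesis by (simp add: ennreal_leI)
  qed
qed

text \<open>Hoeffding's lemma for the centered variable, whose range has length
  \<open>2 * c\<close>. Centering can only raise the exponent, as the mean is nonpositive and
  \<open>t > 0\<close>.\<close>

lemma (in prob_space) nn_integral_exp_bounded: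
  fixes X :: "'a \<Rightarrow> real"
  assumes [measurable]: "X \<in> borel_measurable M" and b: "AE \<omega> in M. \<bar>X \<omega>\<bar> \<le> c"
    and E: "expectation X \<le> 0" and t: "t > 0"
  shows "(\<integral>\<^sup>+\<omega>. ennreal (exp (t * X \<omega>)) \<partial>M) \<le> ennreal (exp (t\<^sup>2 * c\<^sup>2 / 2))"
proof -
  define m where "m = expectation X"
  have int: "integrable M X"
    by (rule integrable_const_bound[of _ c]) (use b in auto)
  interpret Y: interval_bounded_random_variable M "\<lambda>\<omega>. X \<omega> - m" "- c - m" "c - m"
    by unfold_locales (use b in \<open>auto elim!: eventually_mono\<close>)
  have "(\<integral>\<^sup>+\<omega>. ennreal (exp (t * X \<omega>)) \<partial>M) \<le> (\<integral>\<^sup>+\<omega>. ennreal (exp (t * (X \<omega> - m))) \<partial>M)"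
    using E t by (intro nn_integral_mono ennreal_leI) (auto simp: m_def)
  also have "\<dots> \<le> ennreal (exp (t\<^sup>2 * ((c - m) - (- c - m))\<^sup>2 / 8))"
    using int by (intro Y.Hoeffdings_lemma_nn_integral_0 t) (simp add: m_def prob_space)
  also have "\<dots> = ennreal (exp (t\<^sup>2 * c\<^sup>2 / 2))"
    by (simp add: power2_eq_square)
  finally show ?thesis .
qed

subsection \<open>Exponential moments from negative drift\<close>

context iid_sequence
begin

text \<open>For each fixed time the norms, multipliers, distances and weights are almost surely
  bounded, so closure rules for this class settle the integrability of all their products.\<close>

definition ess_bounded :: "('a \<Rightarrow> real) \<Rightarrow> bool" where
  "ess_bounded Y \<longleftrightarrow> Y \<in> borel_measurable M \<and> (\<exists>c. AE \<omega> in M. \<bar>Y \<omega>\<bar> \<le> c)"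

lemma ess_boundedI: "Y \<in> borel_measurable M \<Longrightarrow> AE \<omega> in M. \<bar>Y \<omega>\<bar> \<le> c \<Longrightarrow> ess_bounded Y"
  by (auto simp: ess_bounded_def)

lemma ess_bounded_integrable: "ess_bounded Y \<Longrightarrow> integrable M Y"
  unfolding ess_bounded_def using integrable_const_bound[of Y] by (auto simp: real_norm_def)

lemma ess_bounded_mult:
  assumes "ess_bounded Y" "ess_bounded Y'"
  shows "ess_bounded (\<lambda>\<omega>. Y \<omega> * Y' \<omega>)"
proof -
  obtain c c' where m [measurable]: "Y \<in> borel_measurable M" "Y' \<in> borel_measurable M"
    and c: "AE \<omega> in M. \<bar>Y \<omega>\<bar> \<le> c" "AE \<omega> in M. \<bar>Y' \<omega>\<bar> \<le> c'"
    using assms by (auto simp: ess_bounded_def)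
  have "AE \<omega> in M. \<bar>Y \<omega> * Y' \<omega>\<bar> \<le> c * c'"
    using c by eventually_elim (auto simp: abs_mult intro!: mult_mono)
  then show ?thesis by (intro ess_boundedI) measurable
qed

lemma ess_bounded_add:
  assumes "ess_bounded Y" "ess_bounded Y'"
  shows "ess_bounded (\<lambda>\<omega>. Y \<omega> + Y' \<omega>)"
proof -
  obtain c c' where m [measurable]: "Y \<in> borel_measurable M" "Y' \<in> borel_measurable M"
    and c: "AE \<omega> in M. \<bar>Y \<omega>\<bar> \<le> c" "AE \<omega> in M. \<bar>Y' \<omega>\<bar> \<le> c'"
    using assms by (auto simp: ess_bounded_def)
  have "AE \<omega> in M. \<bar>Y \<omega> + Y' \<omega>\<bar> \<le> c + c'"
    using c by eventually_elim auto
  then show ?thesis by (intro ess_boundedI) measurable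
qed

lemma ess_bounded_const: "ess_bounded (\<lambda>_. c)"
  by (rule ess_boundedI[of _ "\<bar>c\<bar>"]) auto

lemma ess_bounded_diff: "ess_bounded Y \<Longrightarrow> ess_bounded Y' \<Longrightarrow> ess_bounded (\<lambda>\<omega>. Y \<omega> - Y' \<omega>)"
  using ess_bounded_add[of Y "\<lambda>\<omega>. (- 1) * Y' \<omega>"] ess_bounded_mult[OF ess_bounded_const[of "- 1"]]
  by simp

lemma ess_bounded_power: "ess_bounded Y \<Longrightarrow> ess_bounded (\<lambda>\<omega>. (Y \<omega>) ^ n)"
  by (induction n) (auto intro: ess_bounded_mult ess_bounded_const)

lemmas ess_bounded_intros =
  ess_bounded_mult ess_bounded_add ess_bounded_diff ess_bounded_const ess_bounded_power

text \<open>The drift condition \<open>E[Z\<^sub>k\<^sub>+\<^sub>s - Z\<^sub>k | hist k] \<le> -s \<zeta>\<close> on \<open>{Z\<^sub>k \<ge> \<theta>}\<close> is phrased through nonnegative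
  test functions \<open>W\<close> that are measurable with respect to \<open>hist k\<close>.\<close>
lemma drift_exp_moment:
  fixes Z :: "nat \<Rightarrow> 'a \<Rightarrow> real"
  assumes Z_meas: "\<And>k. Z k \<in> borel_measurable (hist k)"
    and Z0: "\<And>\<omega>. \<omega> \<in> space M \<Longrightarrow> Z 0 \<omega> = 0"
    and inc: "AE \<omega> in M. \<forall>k. \<bar>Z (Suc k) \<omega> - Z k \<omega>\<bar> \<le> \<delta>"
    and drift: "\<And>k W. W \<in> borel_measurable (hist k) \<Longrightarrow> ess_bounded W \<Longrightarrow> (\<And>\<omega>. 0 \<le> W \<omega>) \<Longrightarrow>
       (\<And>\<omega>. Z k \<omega> < \<theta> \<Longrightarrow> W \<omega> = 0) \<Longrightarrow>
       expectation (\<lambda>\<omega>. W \<omega> * (Z (k + s) \<omega> - Z k \<omega>)) \<le> - (real s * \<zeta>) * expectation W"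
    and pos: "0 < \<zeta>" "\<zeta> \<le> \<delta>" "0 < s" "0 \<le> \<theta>"
    and r: "r = \<zeta> / (4 * real s * \<delta>\<^sup>2)"
  shows "ess_bounded (\<lambda>\<omega>. exp (r * Z k \<omega>))"
    and "expectation (\<lambda>\<omega>. exp (r * Z k \<omega>)) \<le> exp (r * (\<theta> + real s * \<delta>)) * (8 * \<delta>\<^sup>2 / \<zeta>\<^sup>2)"
proof -
  have [measurable]: "Z k \<in> borel_measurable M" for k
    using measurable_hist[OF Z_meas] .
  have \<delta>: "\<delta> > 0" and r0: "r > 0"
    using pos by (auto simp: r)
  \<comment> \<open>Keeps \<open>r\<close> times an increment over \<open>s\<close> steps within the
    range of \<open>exp_le_quadratic\<close>.\<close>
  have rs: "r * (real s * \<delta>) \<le> 1"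
    using pos \<delta> by (simp add: r power2_eq_square)
  have incn: "AE \<omega> in M. \<forall>k n. \<bar>Z (k + n) \<omega> - Z k \<omega>\<bar> \<le> real n * \<delta>"
    using inc
  proof eventually_elim
    case (elim \<omega>)
    have "\<bar>Z (k + n) \<omega> - Z k \<omega>\<bar> \<le> real n * \<delta>" for k n
    proof (induction n)
      case (Suc n)
      have "\<bar>Z (k + Suc n) \<omega> - Z (k + n) \<omega>\<bar> \<le> \<delta>"
        using elim by simp
      with Suc show ?case by (simp add: algebra_simps)
    qed simp
    then show ?case by blast
  qed
  have exp_le: "AE \<omega> in M. \<forall>k. exp (r * Z k \<omega>) \<le> exp (r * (real k * \<delta>))"
    using incn AE_space
  proof eventually_elim
    case (elim \<omega>)
    have "Z k \<omega> \<le> real k * \<delta>" for k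
      using elim(1)[rule_format, of 0 k] Z0[OF elim(2)] by simp
    then show ?case using r0 by simp
  qed
  show bdd: "ess_bounded (\<lambda>\<omega>. exp (r * Z k \<omega>))" for k
    by (rule ess_boundedI[of _ "exp (r * (real k * \<delta>))"]) (use exp_le in auto)
  \<comment> \<open>The moments satisfy \<open>a k \<le> (1 - q) * a (k - s) + A\<close>, whose
    fixed point is \<open>A / q\<close>. The term \<open>A\<close> covers paths below
    \<open>\<theta>\<close> at the start of the window, which end at most at
    \<open>\<theta> + s * \<delta>\<close>; it also covers the first \<open>s\<close> times.\<close>
  define A where "A = exp (r * (\<theta> + real s * \<delta>))"
  define q where "q = \<zeta>\<^sup>2 / (8 * \<delta>\<^sup>2)"
  have q: "0 < q" "q \<le> 1"
  proof -
    have "\<zeta>\<^sup>2 \<le> \<delta>\<^sup>2" using pos by (intro power_mono) auto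
    moreover have "0 \<le> \<delta>\<^sup>2" by simp
    ultimately have "\<zeta>\<^sup>2 \<le> 8 * \<delta>\<^sup>2" by linarith
    then show "q \<le> 1" using \<delta> by (simp add: q_def)
  qed (use pos \<delta> in \<open>simp add: q_def\<close>)
  have "A \<ge> 0" by (simp add: A_def)
  have "expectation (\<lambda>\<omega>. exp (r * Z k \<omega>)) \<le> A / q" for k
  proof (induction k rule: less_induct)
    case (less k)
    show ?case
    proof (cases "k < s")
      case True
      have "expectation (\<lambda>\<omega>. exp (r * Z k \<omega>)) \<le> expectation (\<lambda>_. exp (r * (real k * \<delta>)))"
        using exp_le by (intro integral_mono_AE ess_bounded_integrable bdd) (auto simp: ess_bounded_const)
      also have "\<dots> = exp (r * (real k * \<delta>))"
        by (simp add: prob_space)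
      also have "\<dots> \<le> A"
      proof -
        have "real k * \<delta> \<le> real s * \<delta>" using True \<delta> by (intro mult_right_mono) auto
        then show ?thesis
          unfolding A_def exp_le_cancel_iff using r0 pos by (intro mult_left_mono) linarith+
      qed
      also have "A \<le> A / q"
        using q \<open>A \<ge> 0\<close> mult_left_mono[of q 1 A] by (simp add: le_divide_eq)
      finally show ?thesis .
    next
      case False
      define j where "j = k - s"
      have j: "k = j + s" "j < k"
        using False pos(3) by (auto simp: j_def)
      \<comment> \<open>The exponential weight itself, cut off below the threshold, is the test
        function for the drift hypothesis.\<close>
      define W where "W = (\<lambda>\<omega>. if Z j \<omega> < \<theta> then 0 else exp (r * Z j \<omega>))"
      have W_meas: "W \<in> borel_measurable (hist j)"
        unfolding W_def using Z_meas[of j] by measurable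
      note [measurable] = measurable_hist[OF W_meas]
      have W_bdd: "ess_bounded W"
        by (rule ess_boundedI[of _ "exp (r * (real j * \<delta>))"])
           (use exp_le in \<open>auto simp: W_def elim!: eventually_mono\<close>)
      have diff_bdd: "ess_bounded (\<lambda>\<omega>. Z k \<omega> - Z j \<omega>)"
        by (rule ess_boundedI[of _ "real s * \<delta>"]) (use incn in \<open>auto simp: j elim!: eventually_mono\<close>)
      note int = ess_bounded_integrable[OF W_bdd] ess_bounded_integrable[OF bdd]
        ess_bounded_integrable[OF ess_bounded_mult[OF W_bdd diff_bdd]]
      define e where "e = 1 + 2 * (r * (real s * \<delta>))\<^sup>2"
      have "AE \<omega> in M. exp (r * Z k \<omega>) \<le> e * W \<omega> + r * (W \<omega> * (Z k \<omega> - Z j \<omega>)) + A"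
        using incn
      proof eventually_elim
        case (elim \<omega>)
        define w where "w = Z k \<omega> - Z j \<omega>"
        have w: "\<bar>w\<bar> \<le> real s * \<delta>"
          using elim by (simp add: w_def j)
        have Zk: "exp (r * Z k \<omega>) = exp (r * Z j \<omega>) * exp (r * w)"
          by (simp add: w_def exp_add[symmetric] algebra_simps)
        show ?case
        proof (cases "Z j \<omega> < \<theta>")
          case True
          have "r * Z k \<omega> \<le> r * (\<theta> + real s * \<delta>)"
            using r0 w True by (intro mult_left_mono) (auto simp: w_def)
          then show ?thesis using True by (simp add: W_def A_def)
        next
          case False
          have rw: "\<bar>r * w\<bar> \<le> r * (real s * \<delta>)"
            using w r0 by (simp add: abs_mult)
          then have "exp (r * w) \<le> 1 + r * w + 2 * (r * w)\<^sup>2"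
            using rs by (intro exp_le_quadratic) linarith
          also have "(r * w)\<^sup>2 \<le> (r * (real s * \<delta>))\<^sup>2"
            using power_mono[OF rw abs_ge_zero, of 2] by simp
          finally have "exp (r * w) \<le> e + r * w"
            by (simp add: e_def)
          then have "exp (r * Z k \<omega>) \<le> exp (r * Z j \<omega>) * (e + r * w)"
            unfolding Zk by (intro mult_left_mono) auto
          then show ?thesis
            using False \<open>A \<ge> 0\<close> by (simp add: W_def w_def algebra_simps)
        qed
      qed
      then have "expectation (\<lambda>\<omega>. exp (r * Z k \<omega>))
          \<le> expectation (\<lambda>\<omega>. e * W \<omega> + r * (W \<omega> * (Z k \<omega> - Z j \<omega>)) + A)"
        using int by (intro integral_mono_AE) auto
      also have "\<dots> = e * expectation W + r * expectation (\<lambda>\<omega>. W \<omega> * (Z k \<omega> - Z j \<omega>)) + A"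
        using int by (simp add: prob_space)
      also have "\<dots> \<le> e * expectation W + r * (- (real s * \<zeta>) * expectation W) + A"
      proof -
        have "expectation (\<lambda>\<omega>. W \<omega> * (Z k \<omega> - Z j \<omega>)) \<le> - (real s * \<zeta>) * expectation W"
          unfolding j(1) by (rule drift[OF W_meas W_bdd]) (auto simp: W_def)
        then show ?thesis
          using r0 by (intro add_mono order_refl mult_left_mono) auto
      qed
      \<comment> \<open>The choice of \<open>r\<close> minimizes the factor
        \<open>1 - r * s * \<zeta> + 2 * (r * s * \<delta>)^2\<close>, and \<open>1 - q\<close> is
        the minimum.\<close>
      also have "\<dots> = (1 - q) * expectation W + A"
      proof -
        have "r * (real s * \<delta>) = \<zeta> / (4 * \<delta>)" "r * (real s * \<zeta>) = 2 * q"
          using pos \<delta> by (simp_all add: r q_def power2_eq_square)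
        moreover have "2 * (\<zeta> / (4 * \<delta>))\<^sup>2 = q"
          by (simp add: q_def power_divide power_mult_distrib)
        ultimately have "e - r * (real s * \<zeta>) = 1 - q"
          by (simp add: e_def)
        then have "(e - r * (real s * \<zeta>)) * expectation W = (1 - q) * expectation W"
          by simp
        then show ?thesis by (simp add: algebra_simps)
      qed
      also have "\<dots> \<le> (1 - q) * (A / q) + A"
      proof -
        have "expectation W \<le> expectation (\<lambda>\<omega>. exp (r * Z j \<omega>))"
          using int by (intro integral_mono) (auto simp: W_def)
        also have "\<dots> \<le> A / q"
          by (rule less.IH[OF j(2)])
        finally show ?thesis
          using q by (intro add_right_mono mult_left_mono) auto
      qed
      also have "\<dots> = A / q"
        using q by (simp add: diff_divide_distrib algebra_simps)
      finally show ?thesis .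
    qed
  qed
  then show "expectation (\<lambda>\<omega>. exp (r * Z k \<omega>)) \<le> exp (r * (\<theta> + real s * \<delta>)) * (8 * \<delta>\<^sup>2 / \<zeta>\<^sup>2)"
    by (simp add: A_def q_def)
qed

end

subsection \<open>One step of the method\<close>

lemma convex_on_sum_family:
  assumes "convex C" "finite I" "\<And>i. i \<in> I \<Longrightarrow> convex_on C (h i)"
  shows "convex_on C (\<lambda>x. \<Sum>i\<in>I. h i x :: real)"
  using assms(2,3)
proof (induction I rule: finite_induct)
  case empty
  then show ?case by (simp add: convex_on_const assms(1))
next
  case (insert i I)
  then show ?case by (simp add: convex_on_add)
qed

lemma convex_on_square_pos_part:
  fixes h :: "'a::real_vector \<Rightarrow> real"
  assumes "convex_on C h"
  shows "convex_on C (\<lambda>y. (max (h y) 0)\<^sup>2)"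
proof (rule convex_onI)
  show "convex C" using assms by (rule convex_on_imp_convex)
next
  fix t :: real and x y assume t: "0 < t" "t < 1" and xy: "x \<in> C" "y \<in> C"
  let ?a = "max (h x) 0" and ?b = "max (h y) 0"
  have "h ((1 - t) *\<^sub>R x + t *\<^sub>R y) \<le> (1 - t) * h x + t * h y"
    using convex_onD[OF assms] t xy by simp
  also have "\<dots> \<le> (1 - t) * ?a + t * ?b"
    using t by (intro add_mono mult_left_mono) auto
  finally have "max (h ((1 - t) *\<^sub>R x + t *\<^sub>R y)) 0 \<le> (1 - t) * ?a + t * ?b"
    using t by simp
  then have "(max (h ((1 - t) *\<^sub>R x + t *\<^sub>R y)) 0)\<^sup>2 \<le> ((1 - t) * ?a + t * ?b)\<^sup>2"
    by (intro power_mono) auto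
  also have "\<dots> = (1 - t) * ?a\<^sup>2 + t * ?b\<^sup>2 - t * (1 - t) * (?a - ?b)\<^sup>2"
    by (simp only: power2_eq_square) (simp only: algebra_simps)
  also have "\<dots> \<le> (1 - t) * ?a\<^sup>2 + t * ?b\<^sup>2"
    using t by simp
  finally show "(max (h ((1 - t) *\<^sub>R x + t *\<^sub>R y)) 0)\<^sup>2 \<le> (1 - t) * (max (h x) 0)\<^sup>2 + t * (max (h y) 0)\<^sup>2" .
qed

locale slpmm =
  fixes C :: "'a::euclidean_space set"
    and F :: "'a \<Rightarrow> 'q::euclidean_space \<Rightarrow> real"
    and G :: "nat \<Rightarrow> 'a \<Rightarrow> 'q \<Rightarrow> real"
    and v0 :: "'a \<Rightarrow> 'q \<Rightarrow> 'a"
    and v :: "nat \<Rightarrow> 'a \<Rightarrow> 'q \<Rightarrow> 'a"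
    and p :: nat
    and \<sigma> \<alpha> :: real
  assumes C: "C \<noteq> {}" "compact C" "convex C"
    and pos: "\<sigma> > 0" "\<alpha> > 0"
begin

abbreviation "L \<equiv> slpmm_L F G v0 v p \<sigma>"
abbreviation "step \<equiv> slpmm_step C F G v0 v p \<sigma> \<alpha>"
abbreviation "iter \<equiv> slpmm_iter C F G v0 v p \<sigma> \<alpha>"

definition obj :: "'a \<Rightarrow> 'q \<Rightarrow> (nat \<Rightarrow> real) \<Rightarrow> 'a \<Rightarrow> real" where
  "obj x z lam y = L x z lam y + \<alpha> / 2 * (norm (y - x))\<^sup>2"

lemma fst_step: "fst (step (x, lam) z) = arg_min_on (obj x z lam) C"
  by (simp add: slpmm_step_def Let_def obj_def[abs_def])

lemma snd_step:
  "snd (step (x, lam) z) i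
    = max (lam i + \<sigma> * (G i x z + inner (v i x z) (fst (step (x, lam) z) - x))) 0"
  by (simp add: slpmm_step_def Let_def)

lemma convex_on_inner: "convex_on C (\<lambda>y. inner u (y - x))" for u x :: 'a
  by (rule convex_onI) (auto simp: C inner_diff_right inner_add_right algebra_simps)

lemma convex_on_L: "convex_on C (L x z lam)"
proof -
  have "convex_on C (\<lambda>y. lam i + \<sigma> * (G i x z + inner (v i x z) (y - x)))" for i
    by (intro convex_on_add convex_on_cmul convex_on_const[THEN iffD2] convex_on_inner C less_imp_le pos)
  then have "convex_on C (\<lambda>y. \<Sum>i=1..p. (max (lam i + \<sigma> * (G i x z + inner (v i x z) (y - x))) 0)\<^sup>2)"
    by (intro convex_on_sum_family convex_on_square_pos_part C) auto
  then have "convex_on C (\<lambda>y. F x z + inner (v0 x z) (y - x)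
     + (1 / (2 * \<sigma>)) * ((\<Sum>i=1..p. (max (lam i + \<sigma> * (G i x z + inner (v i x z) (y - x))) 0)\<^sup>2)
                          + - (\<Sum>i=1..p. (lam i)\<^sup>2)))"
    by (intro convex_on_add convex_on_cmul convex_on_const[THEN iffD2] convex_on_inner C)
       (use pos in auto)
  then show ?thesis
    unfolding slpmm_L_def by simp
qed

lemma continuous_on_obj: "continuous_on C (obj x z lam)"
  unfolding obj_def slpmm_L_def by (intro continuous_intros)

lemma step_in_C: "fst (step (x, lam) z) \<in> C"
  unfolding fst_step by (rule arg_min_on_compact[OF C(2,1) continuous_on_obj])

lemma step_min: "y \<in> C \<Longrightarrow> obj x z lam (fst (step (x, lam) z)) \<le> obj x z lam y"
  unfolding fst_step by (rule arg_min_on_compact[OF C(2,1) continuous_on_obj])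

lemma step_three_point:
  assumes "w \<in> C"
  shows "obj x z lam (fst (step (x, lam) z)) + \<alpha> / 2 * (norm (w - fst (step (x, lam) z)))\<^sup>2
    \<le> obj x z lam w"
  unfolding obj_def
  using step_min[of _ x z lam, unfolded obj_def]
  by (intro prox_three_point[OF C(3) convex_on_L step_in_C assms])

text \<open>The proximal term makes the minimizer unique, which is what the measurability of the
  iterates rests on.\<close>

lemma step_unique:
  assumes "w \<in> C" "obj x z lam w \<le> obj x z lam (fst (step (x, lam) z))"
  shows "w = fst (step (x, lam) z)"
proof -
  have "\<alpha> / 2 * (norm (w - fst (step (x, lam) z)))\<^sup>2 \<le> 0"
    using step_three_point[OF assms(1), of x z lam] assms(2) by linarith
  then show ?thesis
    using pos by (simp add: mult_le_0_iff)
qed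

lemma iter_in_C: "x0 \<in> C \<Longrightarrow> fst (iter x0 zs k) \<in> C"
  by (cases k) (use step_in_C[of "fst (iter x0 zs (k - 1))" "snd (iter x0 zs (k - 1))"] in auto)

lemma iter_mult_nonneg: "snd (iter x0 zs k) i \<ge> 0"
proof (cases k)
  case (Suc j)
  then show ?thesis
    using snd_step[of "fst (iter x0 zs j)" "snd (iter x0 zs j)" "zs j" i] by simp
qed simp

end

locale slpmm_bounded = slpmm C F G v0 v p \<sigma> \<alpha>
  for C :: "'a::euclidean_space set"
    and F :: "'a \<Rightarrow> 'q::euclidean_space \<Rightarrow> real"
    and G :: "nat \<Rightarrow> 'a \<Rightarrow> 'q \<Rightarrow> real"
    and v0 :: "'a \<Rightarrow> 'q \<Rightarrow> 'a"
    and v :: "nat \<Rightarrow> 'a \<Rightarrow> 'q \<Rightarrow> 'a"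
    and p :: nat
    and \<sigma> \<alpha> :: real +
  fixes \<Xi> :: "'q set" and R \<nu>g \<kappa>f \<kappa>g :: real
  assumes v_sub: "\<And>i x z. i \<in> {1..p} \<Longrightarrow> x \<in> C \<Longrightarrow> z \<in> \<Xi> \<Longrightarrow>
                   is_subgrad_on C (\<lambda>y. G i y z) x (v i x z)"
    and v0_sub: "\<And>x z. x \<in> C \<Longrightarrow> z \<in> \<Xi> \<Longrightarrow> is_subgrad_on C (\<lambda>y. F y z) x (v0 x z)"
    and diam: "\<And>x' x''. x' \<in> C \<Longrightarrow> x'' \<in> C \<Longrightarrow> norm (x' - x'') \<le> R"
    and G_bound: "\<And>x z. x \<in> C \<Longrightarrow> z \<in> \<Xi> \<Longrightarrow> L2_set (\<lambda>i. G i x z) {1..p} \<le> \<nu>g"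
    and v0_bound: "\<And>x z. x \<in> C \<Longrightarrow> z \<in> \<Xi> \<Longrightarrow> norm (v0 x z) \<le> \<kappa>f"
    and v_bound: "\<And>i x z. i \<in> {1..p} \<Longrightarrow> x \<in> C \<Longrightarrow> z \<in> \<Xi> \<Longrightarrow> norm (v i x z) \<le> \<kappa>g"
    and \<Xi>_nonempty: "\<Xi> \<noteq> {}"
begin

definition "\<beta> = \<nu>g + sqrt (real p) * \<kappa>g * R"

lemma R_nonneg: "0 \<le> R" and \<kappa>f_nonneg: "0 \<le> \<kappa>f" and \<nu>g_nonneg: "0 \<le> \<nu>g"
proof -
  obtain x z where xz: "x \<in> C" "z \<in> \<Xi>" using C \<Xi>_nonempty by blast
  show "0 \<le> R" using diam[OF xz(1) xz(1)] by simp
  show "0 \<le> \<kappa>f" using v0_bound[OF xz] norm_ge_zero[of "v0 x z"] by linarith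
  show "0 \<le> \<nu>g" using G_bound[OF xz] L2_set_nonneg[of "\<lambda>i. G i x z" "{1..p}"] by linarith
qed

text \<open>Without constraints nothing determines the sign of \<open>\<kappa>g\<close>, but then
  the factor \<open>sqrt p\<close> vanishes.\<close>

lemma sqrt_p_\<kappa>g_nonneg: "0 \<le> sqrt (real p) * \<kappa>g"
proof (cases "p = 0")
  case False
  obtain x z where xz: "x \<in> C" "z \<in> \<Xi>" using C \<Xi>_nonempty by blast
  have "norm (v p x z) \<le> \<kappa>g"
    using v_bound[OF _ xz, of p] False by simp
  then have "0 \<le> \<kappa>g"
    by (rule order_trans[OF norm_ge_zero])
  then show ?thesis by simp
qed simp

lemma \<nu>g_le_\<beta>: "\<nu>g \<le> \<beta>"
  using sqrt_p_\<kappa>g_nonneg R_nonneg by (simp add: \<beta>_def)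

text \<open>The three-point inequality with its penalty evaluated at both ends. At \<open>w\<close>
  the linearized constraints lie below \<open>G i w z\<close>, and a positive part of a smaller
  number is bounded by the absolute value of the larger one.\<close>

lemma step_basic:
  assumes x: "x \<in> C" and z: "z \<in> \<Xi>" and w: "w \<in> C" and lam: "\<And>i. 0 \<le> lam i"
  defines "x' \<equiv> fst (step (x, lam) z)" and "lam' \<equiv> snd (step (x, lam) z)"
  shows "inner (v0 x z) (x' - x) + ((L2_set lam' {1..p})\<^sup>2 - (L2_set lam {1..p})\<^sup>2) / (2 * \<sigma>)
      + \<alpha> / 2 * (norm (x' - x))\<^sup>2 + \<alpha> / 2 * (norm (w - x'))\<^sup>2
    \<le> inner (v0 x z) (w - x) + (\<Sum>i=1..p. lam i * G i w z) + \<sigma> * \<nu>g\<^sup>2 / 2 + \<alpha> / 2 * (norm (w - x))\<^sup>2"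
proof -
  have sq: "(L2_set l {1..p})\<^sup>2 = (\<Sum>i=1..p. (l i)\<^sup>2)" for l :: "nat \<Rightarrow> real"
    by (simp add: L2_set_def sum_nonneg)
  have "(max (lam i + \<sigma> * (G i x z + inner (v i x z) (w - x))) 0)\<^sup>2 \<le> (lam i + \<sigma> * G i w z)\<^sup>2"
    if "i \<in> {1..p}" for i
  proof -
    have "G i x z + inner (v i x z) (w - x) \<le> G i w z"
      using v_sub[OF that x z] w by (simp add: is_subgrad_on_def)
    then have "\<sigma> * (G i x z + inner (v i x z) (w - x)) \<le> \<sigma> * G i w z"
      using pos by simp
    then have "\<bar>max (lam i + \<sigma> * (G i x z + inner (v i x z) (w - x))) 0\<bar> \<le> \<bar>lam i + \<sigma> * G i w z\<bar>"
      by linarith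
    then show ?thesis by (simp only: abs_le_square_iff)
  qed
  then have "(\<Sum>i=1..p. (max (lam i + \<sigma> * (G i x z + inner (v i x z) (w - x))) 0)\<^sup>2)
      \<le> (\<Sum>i=1..p. (lam i + \<sigma> * G i w z)\<^sup>2)"
    by (rule sum_mono)
  also have "\<dots> = (\<Sum>i=1..p. (lam i)\<^sup>2) + 2 * \<sigma> * (\<Sum>i=1..p. lam i * G i w z) + \<sigma>\<^sup>2 * (\<Sum>i=1..p. (G i w z)\<^sup>2)"
  proof -
    have "(lam i + \<sigma> * G i w z)\<^sup>2 = (lam i)\<^sup>2 + (2 * \<sigma>) * (lam i * G i w z) + \<sigma>\<^sup>2 * (G i w z)\<^sup>2" for i
      by (simp add: power2_eq_square algebra_simps)
    then show ?thesis
      by (simp only: sum.distrib sum_distrib_left)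
  qed
  also have "(\<Sum>i=1..p. (G i w z)\<^sup>2) = (L2_set (\<lambda>i. G i w z) {1..p})\<^sup>2"
    by (rule sq[symmetric])
  also have "\<dots> \<le> \<nu>g\<^sup>2"
    by (intro power_mono G_bound w z L2_set_nonneg)
  finally have "(\<Sum>i=1..p. (max (lam i + \<sigma> * (G i x z + inner (v i x z) (w - x))) 0)\<^sup>2)
      \<le> (\<Sum>i=1..p. (lam i)\<^sup>2) + 2 * \<sigma> * (\<Sum>i=1..p. lam i * G i w z) + \<sigma>\<^sup>2 * \<nu>g\<^sup>2"
    by (simp add: mult_left_mono)
  then have "1 / (2 * \<sigma>) * ((\<Sum>i=1..p. (max (lam i + \<sigma> * (G i x z + inner (v i x z) (w - x))) 0)\<^sup>2)
        - (\<Sum>i=1..p. (lam i)\<^sup>2))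
      \<le> 1 / (2 * \<sigma>) * (2 * \<sigma> * (\<Sum>i=1..p. lam i * G i w z) + \<sigma>\<^sup>2 * \<nu>g\<^sup>2)"
    using pos by (intro mult_left_mono) auto
  also have "\<dots> = (\<Sum>i=1..p. lam i * G i w z) + \<sigma> * \<nu>g\<^sup>2 / 2"
    using pos by (simp add: field_simps power2_eq_square)
  finally have "L x z lam w \<le> F x z + inner (v0 x z) (w - x) + (\<Sum>i=1..p. lam i * G i w z) + \<sigma> * \<nu>g\<^sup>2 / 2"
    by (simp add: slpmm_L_def)
  \<comment> \<open>At the new point the positive parts in the penalty are exactly the updated
    multipliers, so the penalty is a difference of squared norms.\<close>
  moreover have "L x z lam x' = F x z + inner (v0 x z) (x' - x)
      + ((L2_set lam' {1..p})\<^sup>2 - (L2_set lam {1..p})\<^sup>2) / (2 * \<sigma>)"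
    unfolding slpmm_L_def sq lam'_def snd_step x'_def by simp
  moreover have "L x z lam x' + \<alpha> / 2 * (norm (x' - x))\<^sup>2 + \<alpha> / 2 * (norm (w - x'))\<^sup>2
      \<le> L x z lam w + \<alpha> / 2 * (norm (w - x))\<^sup>2"
    using step_three_point[OF w, of x z lam] unfolding x'_def obj_def .
  ultimately show ?thesis by linarith
qed

text \<open>Taking positive parts is nonexpansive and old multipliers are nonnegative, so each
  coordinate moves by at most \<open>\<sigma>\<close> times its linearized constraint. The vector of
  these has norm at most \<open>\<beta>\<close>.\<close>

lemma step_increment:
  assumes x: "x \<in> C" and z: "z \<in> \<Xi>" and lam: "\<And>i. 0 \<le> lam i"
  shows "\<bar>L2_set (snd (step (x, lam) z)) {1..p} - L2_set lam {1..p}\<bar> \<le> \<sigma> * \<beta>"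
proof -
  define x' lam' where "x' = fst (step (x, lam) z)" and "lam' = snd (step (x, lam) z)"
  have x': "x' \<in> C" unfolding x'_def by (rule step_in_C)
  define b where "b = (\<lambda>i. inner (v i x z) (x' - x))"
  have b: "\<bar>b i\<bar> \<le> \<kappa>g * R" if "i \<in> {1..p}" for i
  proof -
    have "\<bar>b i\<bar> \<le> norm (v i x z) * norm (x' - x)"
      unfolding b_def by (rule Cauchy_Schwarz_ineq2)
    also have "\<dots> \<le> \<kappa>g * R"
      using v_bound[OF that x z] diam[OF x' x] by (intro mult_mono) (auto intro: order_trans[OF norm_ge_zero])
    finally show ?thesis .
  qed
  have "L2_set b {1..p} = L2_set (\<lambda>i. \<bar>b i\<bar>) {1..p}"
    by (simp add: L2_set_def)
  also have "\<dots> \<le> L2_set (\<lambda>_. \<kappa>g * R) {1..p}"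
    using b by (intro L2_set_mono) auto
  also have "\<dots> = sqrt (real p) * (\<bar>\<kappa>g * R\<bar>)"
    by (simp add: L2_set_def real_sqrt_mult)
  also have "\<dots> = sqrt (real p) * \<kappa>g * R"
    using sqrt_p_\<kappa>g_nonneg R_nonneg by (cases "p = 0") (auto simp: zero_le_mult_iff)
  finally have "L2_set b {1..p} \<le> sqrt (real p) * \<kappa>g * R" .
  moreover have "L2_set (\<lambda>i. G i x z + b i) {1..p} \<le> L2_set (\<lambda>i. G i x z) {1..p} + L2_set b {1..p}"
    by (rule L2_set_triangle_ineq)
  ultimately have "L2_set (\<lambda>i. G i x z + b i) {1..p} \<le> \<beta>"
    using G_bound[OF x z] by (simp add: \<beta>_def)
  then have "\<sigma> * L2_set (\<lambda>i. G i x z + b i) {1..p} \<le> \<sigma> * \<beta>"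
    using pos by simp
  then have u: "L2_set (\<lambda>i. \<bar>\<sigma> * (G i x z + b i)\<bar>) {1..p} \<le> \<sigma> * \<beta>"
    using pos by (subst (asm) L2_set_right_distrib) (auto simp: L2_set_def)
  have lam': "lam' i = max (lam i + \<sigma> * (G i x z + b i)) 0" for i
    unfolding lam'_def snd_step b_def x'_def ..
  have lam'0: "0 \<le> lam' i" for i
    by (simp add: lam')
  have "L2_set lam' {1..p} \<le> L2_set (\<lambda>i. lam i + \<bar>\<sigma> * (G i x z + b i)\<bar>) {1..p}"
    using lam'0 lam by (intro L2_set_mono) (auto simp: lam' abs_if)
  also have "\<dots> \<le> L2_set lam {1..p} + L2_set (\<lambda>i. \<bar>\<sigma> * (G i x z + b i)\<bar>) {1..p}"
    by (rule L2_set_triangle_ineq)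
  finally have 1: "L2_set lam' {1..p} - L2_set lam {1..p} \<le> \<sigma> * \<beta>" using u by linarith
  have "L2_set lam {1..p} \<le> L2_set (\<lambda>i. lam' i + \<bar>\<sigma> * (G i x z + b i)\<bar>) {1..p}"
    using lam by (intro L2_set_mono) (auto simp: lam' abs_if)
  also have "\<dots> \<le> L2_set lam' {1..p} + L2_set (\<lambda>i. \<bar>\<sigma> * (G i x z + b i)\<bar>) {1..p}"
    by (rule L2_set_triangle_ineq)
  finally have 2: "L2_set lam {1..p} - L2_set lam' {1..p} \<le> \<sigma> * \<beta>" using u by linarith
  from 1 2 show ?thesis by (simp add: lam'_def)
qed

end

subsection \<open>The random iteration\<close>

lemma measurable_pair_compose:
  fixes h :: "'b::second_countable_topology \<Rightarrow> 'c::second_countable_topology \<Rightarrow> 'd::topological_space"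
  assumes "(\<lambda>(x, z). h x z) \<in> borel_measurable borel"
    and "X \<in> borel_measurable N" "Z \<in> borel_measurable N"
  shows "(\<lambda>w. h (X w) (Z w)) \<in> borel_measurable N"
proof -
  have "(\<lambda>w. (X w, Z w)) \<in> N \<rightarrow>\<^sub>M borel"
    using assms(2,3) unfolding borel_prod[symmetric] by (rule measurable_Pair)
  from measurable_compose[OF this assms(1)] show ?thesis by simp
qed

locale slpmm_process =
  slpmm_bounded C F G v0 v p \<sigma> \<alpha> \<Xi> R \<nu>g \<kappa>f \<kappa>g + iid_sequence M "borel :: 'q measure" \<xi> \<mu>
  for C :: "'a::euclidean_space set"
    and F :: "'a \<Rightarrow> 'q::euclidean_space \<Rightarrow> real"
    and G :: "nat \<Rightarrow> 'a \<Rightarrow> 'q \<Rightarrow> real"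
    and v0 :: "'a \<Rightarrow> 'q \<Rightarrow> 'a"
    and v :: "nat \<Rightarrow> 'a \<Rightarrow> 'q \<Rightarrow> 'a"
    and p :: nat
    and \<sigma> \<alpha> :: real
    and \<Xi> :: "'q set"
    and R \<nu>g \<kappa>f \<kappa>g :: real
    and M :: "'w measure"
    and \<xi> :: "nat \<Rightarrow> 'w \<Rightarrow> 'q"
    and \<mu> :: "'q measure" +
  fixes x0 :: 'a
  assumes supp: "AE z in \<mu>. z \<in> \<Xi>"
    and F_meas: "(\<lambda>(x, z). F x z) \<in> borel_measurable borel"
    and G_meas: "\<And>i. (\<lambda>(x, z). G i x z) \<in> borel_measurable borel"
    and v0_meas: "(\<lambda>(x, z). v0 x z) \<in> borel_measurable borel"
    and v_meas: "\<And>i. (\<lambda>(x, z). v i x z) \<in> borel_measurable borel"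
    and x0: "x0 \<in> C"
    and F_int: "\<And>x. x \<in> C \<Longrightarrow> integrable \<mu> (F x)"
    and G_int: "\<And>i x. i \<in> {1..p} \<Longrightarrow> x \<in> C \<Longrightarrow> integrable \<mu> (G i x)"
begin

lemmas data_measurable [measurable] =
  measurable_pair_compose[OF F_meas] measurable_pair_compose[OF G_meas]
  measurable_pair_compose[OF v0_meas] measurable_pair_compose[OF v_meas]

text \<open>Stated over an arbitrary space \<open>N\<close> so that \<open>hist k\<close> can be
  inserted later. Point and multipliers go through one induction because the subproblem depends on
  both.\<close>

lemma iter_measurable:
  assumes "\<And>j. j < k \<Longrightarrow> (\<lambda>w. zs w j) \<in> borel_measurable N"
  shows "(\<lambda>w. fst (iter x0 (zs w) k)) \<in> borel_measurable N \<and>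
    (\<forall>i. (\<lambda>w. snd (iter x0 (zs w) k) i) \<in> borel_measurable N)"
  using assms
proof (induction k)
  case 0
  then show ?case by simp
next
  case (Suc k)
  have [measurable]: "(\<lambda>w. fst (iter x0 (zs w) k)) \<in> borel_measurable N"
      "\<And>i. (\<lambda>w. snd (iter x0 (zs w) k) i) \<in> borel_measurable N"
      "(\<lambda>w. zs w k) \<in> borel_measurable N"
    using Suc by auto
  define h where "h = (\<lambda>w. obj (fst (iter x0 (zs w) k)) (zs w k) (snd (iter x0 (zs w) k)))"
  have eq: "fst (iter x0 (zs w) (Suc k))
      = fst (step (fst (iter x0 (zs w) k), snd (iter x0 (zs w) k)) (zs w k))" for w
    by simp
  have fst_meas [measurable]: "(\<lambda>w. fst (iter x0 (zs w) (Suc k))) \<in> borel_measurable N"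
  proof (rule measurable_unique_minimizer[OF C(2), of N h])
    fix y assume "y \<in> C"
    show "(\<lambda>w. h w y) \<in> borel_measurable N"
      unfolding h_def obj_def slpmm_L_def by measurable
  qed (unfold eq h_def, (rule continuous_on_obj step_in_C step_min step_unique; assumption)+)
  have "snd (iter x0 (zs w) (Suc k)) i = max (snd (iter x0 (zs w) k) i + \<sigma> *
      (G i (fst (iter x0 (zs w) k)) (zs w k) + inner (v i (fst (iter x0 (zs w) k)) (zs w k))
        (fst (iter x0 (zs w) (Suc k)) - fst (iter x0 (zs w) k)))) 0" for w i
    using snd_step[of "fst (iter x0 (zs w) k)" "snd (iter x0 (zs w) k)" "zs w k" i] by simp
  then have "(\<lambda>w. snd (iter x0 (zs w) (Suc k)) i) \<in> borel_measurable N" for i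
    by (simp only:) measurable
  with fst_meas show ?case by blast
qed

definition X :: "nat \<Rightarrow> 'w \<Rightarrow> 'a" where "X k \<omega> = fst (iter x0 (\<lambda>j. \<xi> j \<omega>) k)"
definition Lam :: "nat \<Rightarrow> 'w \<Rightarrow> nat \<Rightarrow> real" where "Lam k \<omega> = snd (iter x0 (\<lambda>j. \<xi> j \<omega>) k)"
definition Z :: "nat \<Rightarrow> 'w \<Rightarrow> real" where "Z k \<omega> = L2_set (Lam k \<omega>) {1..p}"

lemma X_hist: "X k \<in> borel_measurable (hist k)"
  and Lam_hist: "(\<lambda>\<omega>. Lam k \<omega> i) \<in> borel_measurable (hist k)"
  using iter_measurable[of k "\<lambda>\<omega> j. \<xi> j \<omega>" "hist k"] \<xi>_measurable_hist
  by (auto simp: X_def[abs_def] Lam_def[abs_def])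

lemma Z_hist: "Z k \<in> borel_measurable (hist k)"
  using Lam_hist unfolding Z_def[abs_def] L2_set_def by measurable

lemmas process_measurable [measurable] =
  measurable_hist[OF X_hist] measurable_hist[OF Lam_hist] measurable_hist[OF Z_hist]

lemma X_in_C: "X k \<omega> \<in> C"
  unfolding X_def by (rule iter_in_C[OF x0])

lemma Lam_nonneg: "0 \<le> Lam k \<omega> i"
  unfolding Lam_def by (rule iter_mult_nonneg)

lemma Z_0: "Z 0 \<omega> = 0"
  by (simp add: Z_def Lam_def L2_set_def)

lemma Suc_process:
  "X (Suc k) \<omega> = fst (step (X k \<omega>, Lam k \<omega>) (\<xi> k \<omega>))"
  "Lam (Suc k) \<omega> = snd (step (X k \<omega>, Lam k \<omega>) (\<xi> k \<omega>))"
  by (simp_all add: X_def Lam_def)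

lemma AE_sample: "AE \<omega> in M. \<forall>k. \<xi> k \<omega> \<in> \<Xi>"
  by (rule AE_\<xi>[OF supp])

lemma process_basic:
  assumes "\<xi> k \<omega> \<in> \<Xi>" "w \<in> C"
  shows "inner (v0 (X k \<omega>) (\<xi> k \<omega>)) (X (Suc k) \<omega> - X k \<omega>) + ((Z (Suc k) \<omega>)\<^sup>2 - (Z k \<omega>)\<^sup>2) / (2 * \<sigma>)
      + \<alpha> / 2 * (norm (X (Suc k) \<omega> - X k \<omega>))\<^sup>2 + \<alpha> / 2 * (norm (w - X (Suc k) \<omega>))\<^sup>2
    \<le> inner (v0 (X k \<omega>) (\<xi> k \<omega>)) (w - X k \<omega>) + (\<Sum>i=1..p. Lam k \<omega> i * G i w (\<xi> k \<omega>))
      + \<sigma> * \<nu>g\<^sup>2 / 2 + \<alpha> / 2 * (norm (w - X k \<omega>))\<^sup>2"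
  using step_basic[OF X_in_C[of k \<omega>] assms Lam_nonneg[of k \<omega>]] by (simp add: Suc_process Z_def)

lemma Z_increment: "\<xi> k \<omega> \<in> \<Xi> \<Longrightarrow> \<bar>Z (Suc k) \<omega> - Z k \<omega>\<bar> \<le> \<sigma> * \<beta>"
  using step_increment[OF X_in_C[of k \<omega>] _ Lam_nonneg[of k \<omega>], of "\<xi> k \<omega>"] by (simp add: Suc_process Z_def)

lemma Z_increments:
  assumes "\<forall>k. \<xi> k \<omega> \<in> \<Xi>"
  shows "\<bar>Z (k + n) \<omega> - Z k \<omega>\<bar> \<le> real n * (\<sigma> * \<beta>)"
proof (induction n)
  case (Suc n)
  have "\<bar>Z (k + Suc n) \<omega> - Z (k + n) \<omega>\<bar> \<le> \<sigma> * \<beta>"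
    using Z_increment[of "k + n" \<omega>] assms by simp
  with Suc show ?case by (simp add: algebra_simps)
qed simp

lemma Lam_le_Z: "i \<in> {1..p} \<Longrightarrow> Lam k \<omega> i \<le> Z k \<omega>"
  unfolding Z_def by (rule member_le_L2_set) auto

lemma ess_bounded_Z: "ess_bounded (Z k)"
proof (rule ess_boundedI)
  show "AE \<omega> in M. \<bar>Z k \<omega>\<bar> \<le> real k * (\<sigma> * \<beta>)"
    using AE_sample by eventually_elim (use Z_increments[of _ 0 k] Z_0 in auto)
qed measurable

lemma ess_bounded_Lam: "i \<in> {1..p} \<Longrightarrow> ess_bounded (\<lambda>\<omega>. Lam k \<omega> i)"
proof (rule ess_boundedI)
  assume i: "i \<in> {1..p}"
  show "AE \<omega> in M. \<bar>Lam k \<omega> i\<bar> \<le> real k * (\<sigma> * \<beta>)"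
    using AE_sample
  proof eventually_elim
    case (elim \<omega>)
    then show ?case
      using Z_increments[of \<omega> 0 k] Z_0[of \<omega>] Lam_le_Z[OF i, of k \<omega>] Lam_nonneg[of k \<omega> i] by simp
  qed
qed measurable

section \<open>Negative drift and tails of the multiplier norm\<close>

definition d :: "'a \<Rightarrow> nat \<Rightarrow> 'w \<Rightarrow> real" where "d w k \<omega> = (norm (w - X k \<omega>))\<^sup>2"

lemma d_bounds: "w \<in> C \<Longrightarrow> 0 \<le> d w k \<omega>" "w \<in> C \<Longrightarrow> d w k \<omega> \<le> R\<^sup>2"
  unfolding d_def using diam[OF _ X_in_C] by (auto intro: power_mono)

lemma ess_bounded_d: "w \<in> C \<Longrightarrow> ess_bounded (d w k)"
  by (rule ess_boundedI[of _ "R\<^sup>2"]) (unfold d_def[abs_def], use d_bounds[of w k] in \<open>auto simp: d_def\<close>)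

lemma \<beta>_nonneg: "0 \<le> \<beta>"
  using \<nu>g_nonneg \<nu>g_le_\<beta> by linarith

lemma sum_Lam_ge_Z: "Z k \<omega> \<le> (\<Sum>i=1..p. Lam k \<omega> i)"
  unfolding Z_def by (rule L2_set_le_sum) (simp add: Lam_nonneg)

text \<open>Each step inequality is multiplied by \<open>2 * \<sigma> * W\<close>. The weight and
  the current multipliers are independent of the new sample, so constraint values may be replaced by
  their means, at most \<open>- \<epsilon>\<close>; the distance terms telescope.\<close>

lemma weighted_energy:
  fixes \<epsilon> :: real
  assumes w: "w \<in> C" and \<epsilon>: "\<epsilon> \<ge> 0" "\<And>i. i \<in> {1..p} \<Longrightarrow> (\<integral>z. G i w z \<partial>\<mu>) \<le> - \<epsilon>"
    and W: "W \<in> borel_measurable (hist k)" "ess_bounded W" "\<And>\<omega>. 0 \<le> W \<omega>"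
  shows "expectation (\<lambda>\<omega>. W \<omega> * (Z (k + n) \<omega>)\<^sup>2) \<le> expectation (\<lambda>\<omega>. W \<omega> * ((Z k \<omega>)\<^sup>2
      + real n * (2 * \<sigma> * \<kappa>f * R + \<sigma>\<^sup>2 * \<nu>g\<^sup>2) + \<sigma> * \<alpha> * (d w k \<omega> - d w (k + n) \<omega>)
      - 2 * \<sigma> * \<epsilon> * (real n * Z k \<omega>) + \<sigma>\<^sup>2 * \<epsilon> * \<beta> * (real n * (real n - 1))))"
proof (induction n)
  case 0
  then show ?case by simp
next
  case (Suc n)
  define m where "m = k + n"
  define a where "a = 2 * \<sigma> * \<kappa>f * R + \<sigma>\<^sup>2 * \<nu>g\<^sup>2"
  note bdd = ess_bounded_intros W(2) ess_bounded_Z ess_bounded_Lam ess_bounded_d[OF w]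
  define S where "S = (\<lambda>\<omega>. \<Sum>i=1..p. W \<omega> * Lam m \<omega> i * G i w (\<xi> m \<omega>))"
  have S1: "integrable M (\<lambda>\<omega>. W \<omega> * Lam m \<omega> i * G i w (\<xi> m \<omega>))"
      "expectation (\<lambda>\<omega>. W \<omega> * Lam m \<omega> i * G i w (\<xi> m \<omega>))
        = expectation (\<lambda>\<omega>. W \<omega> * Lam m \<omega> i) * (\<integral>z. G i w z \<partial>\<mu>)"
    if i: "i \<in> {1..p}" for i
  proof -
    have 1: "(\<lambda>\<omega>. W \<omega> * Lam m \<omega> i) \<in> borel_measurable (hist m)"
      by (intro borel_measurable_times Lam_hist measurable_hist_mono[OF W(1)]) (simp add: m_def)
    have 2: "integrable M (\<lambda>\<omega>. W \<omega> * Lam m \<omega> i)"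
      by (intro ess_bounded_integrable bdd i)
    show "integrable M (\<lambda>\<omega>. W \<omega> * Lam m \<omega> i * G i w (\<xi> m \<omega>))"
        "expectation (\<lambda>\<omega>. W \<omega> * Lam m \<omega> i * G i w (\<xi> m \<omega>))
        = expectation (\<lambda>\<omega>. W \<omega> * Lam m \<omega> i) * (\<integral>z. G i w z \<partial>\<mu>)"
      using integral_hist_mult[OF 1 2 G_int[OF i w]] by auto
  qed
  have intS: "integrable M S"
    unfolding S_def by (intro Bochner_Integration.integrable_sum S1)
  have "expectation S = (\<Sum>i=1..p. expectation (\<lambda>\<omega>. W \<omega> * Lam m \<omega> i) * (\<integral>z. G i w z \<partial>\<mu>))"
    unfolding S_def using S1 by (subst Bochner_Integration.integral_sum) auto
  also have "\<dots> \<le> (\<Sum>i=1..p. expectation (\<lambda>\<omega>. W \<omega> * Lam m \<omega> i) * (- \<epsilon>))"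
    by (intro sum_mono mult_left_mono \<epsilon> integral_nonneg) (auto simp: W Lam_nonneg)
  also have "\<dots> = - \<epsilon> * expectation (\<lambda>\<omega>. \<Sum>i=1..p. W \<omega> * Lam m \<omega> i)"
    by (subst Bochner_Integration.integral_sum)
       (auto simp: sum_distrib_left mult.commute intro!: ess_bounded_integrable bdd)
  \<comment> \<open>The gain is expressed through the norm at the start of the window, which costs
    \<open>n * \<sigma> * \<beta>\<close> after \<open>n\<close> steps. Twice these losses add up to
    the factor \<open>n * (n - 1)\<close>.\<close>
  also have "\<dots> \<le> - \<epsilon> * expectation (\<lambda>\<omega>. W \<omega> * (Z k \<omega> - real n * (\<sigma> * \<beta>)))"
  proof -
    have "AE \<omega> in M. W \<omega> * (Z k \<omega> - real n * (\<sigma> * \<beta>)) \<le> (\<Sum>i=1..p. W \<omega> * Lam m \<omega> i)"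
      using AE_sample
    proof eventually_elim
      case (elim \<omega>)
      have "Z k \<omega> - real n * (\<sigma> * \<beta>) \<le> (\<Sum>i=1..p. Lam m \<omega> i)"
        using Z_increments[OF elim, of k n] sum_Lam_ge_Z[of m \<omega>] unfolding m_def by linarith
      from mult_left_mono[OF this W(3)[of \<omega>]] show ?case by (simp add: sum_distrib_left)
    qed
    then have "expectation (\<lambda>\<omega>. W \<omega> * (Z k \<omega> - real n * (\<sigma> * \<beta>))) \<le> expectation (\<lambda>\<omega>. \<Sum>i=1..p. W \<omega> * Lam m \<omega> i)"
      by (intro integral_mono_AE Bochner_Integration.integrable_sum ess_bounded_integrable bdd)
    from mult_left_mono[OF this \<epsilon>(1)] show ?thesis by simp
  qed
  finally have ES: "expectation S \<le> - \<epsilon> * expectation (\<lambda>\<omega>. W \<omega> * (Z k \<omega> - real n * (\<sigma> * \<beta>)))" .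
  define T where "T = (\<lambda>\<omega>. W \<omega> * (a + \<sigma> * \<alpha> * (d w m \<omega> - d w (Suc m) \<omega>)))"
  define Q where "Q = (\<lambda>\<omega>. W \<omega> * ((Z k \<omega>)\<^sup>2
      + real n * a + \<sigma> * \<alpha> * (d w k \<omega> - d w (k + n) \<omega>)
      - 2 * \<sigma> * \<epsilon> * (real n * Z k \<omega>) + \<sigma>\<^sup>2 * \<epsilon> * \<beta> * (real n * (real n - 1))))"
  have intT: "integrable M T" and intQ: "integrable M Q"
    unfolding T_def Q_def by (intro ess_bounded_integrable bdd)+
  have intZ: "integrable M (\<lambda>\<omega>. W \<omega> * (Z j \<omega>)\<^sup>2)" for j
    by (intro ess_bounded_integrable bdd)
  have intV: "integrable M (\<lambda>\<omega>. W \<omega> * (Z k \<omega> - real n * (\<sigma> * \<beta>)))"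
    by (intro ess_bounded_integrable bdd)
  have "AE \<omega> in M. W \<omega> * (Z (k + Suc n) \<omega>)\<^sup>2 \<le> W \<omega> * (Z m \<omega>)\<^sup>2 + T \<omega> + 2 * \<sigma> * S \<omega>"
    using AE_sample
  proof eventually_elim
    case (elim \<omega>)
    define x x' z where "x = X m \<omega>" and "x' = X (Suc m) \<omega>" and "z = \<xi> m \<omega>"
    have z: "z \<in> \<Xi>" using elim by (simp add: z_def)
    have "inner (v0 x z) (w - x) - inner (v0 x z) (x' - x) = inner (v0 x z) (w - x')"
      by (simp add: inner_diff_right)
    also have "\<dots> \<le> norm (v0 x z) * norm (w - x')"
      by (rule norm_cauchy_schwarz)
    also have "\<dots> \<le> \<kappa>f * R"
      using v0_bound[OF X_in_C z, of m \<omega>] diam[OF w X_in_C, of "Suc m" \<omega>] \<kappa>f_nonneg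
      by (intro mult_mono) (auto simp: x_def x'_def)
    finally have lin: "inner (v0 x z) (w - x) - inner (v0 x z) (x' - x) \<le> \<kappa>f * R" .
    define S0 where "S0 = (\<Sum>i=1..p. Lam m \<omega> i * G i w z)"
    have "0 \<le> \<alpha> / 2 * (norm (x' - x))\<^sup>2" using pos by simp
    then have "((Z (Suc m) \<omega>)\<^sup>2 - (Z m \<omega>)\<^sup>2) / (2 * \<sigma>)
        \<le> \<kappa>f * R + S0 + \<sigma> * \<nu>g\<^sup>2 / 2 + \<alpha> / 2 * d w m \<omega> - \<alpha> / 2 * d w (Suc m) \<omega>"
      using process_basic[OF elim[rule_format, of m] w] lin
      unfolding d_def x_def[symmetric] x'_def[symmetric] z_def[symmetric] S0_def[symmetric]
      by linarith
    then have le: "2 * \<sigma> * (((Z (Suc m) \<omega>)\<^sup>2 - (Z m \<omega>)\<^sup>2) / (2 * \<sigma>))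
        \<le> 2 * \<sigma> * (\<kappa>f * R + S0 + \<sigma> * \<nu>g\<^sup>2 / 2 + \<alpha> / 2 * d w m \<omega> - \<alpha> / 2 * d w (Suc m) \<omega>)"
      using pos by (intro mult_left_mono) auto
    have "(Z (Suc m) \<omega>)\<^sup>2 \<le> (Z m \<omega>)\<^sup>2 + (a + \<sigma> * \<alpha> * (d w m \<omega> - d w (Suc m) \<omega>)) + 2 * \<sigma> * S0"
    proof -
      have "2 * \<sigma> * (((Z (Suc m) \<omega>)\<^sup>2 - (Z m \<omega>)\<^sup>2) / (2 * \<sigma>)) = (Z (Suc m) \<omega>)\<^sup>2 - (Z m \<omega>)\<^sup>2"
        using pos by simp
      with le show ?thesis by (simp add: a_def power2_eq_square algebra_simps)
    qed
    from mult_left_mono[OF this W(3)[of \<omega>]]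
    show ?case
      by (simp add: T_def S_def S0_def m_def z_def algebra_simps sum_distrib_left)
  qed
  then have "expectation (\<lambda>\<omega>. W \<omega> * (Z (k + Suc n) \<omega>)\<^sup>2)
      \<le> expectation (\<lambda>\<omega>. W \<omega> * (Z m \<omega>)\<^sup>2 + T \<omega> + 2 * \<sigma> * S \<omega>)"
    using intZ intT intS by (intro integral_mono_AE) auto
  also have "\<dots> = expectation (\<lambda>\<omega>. W \<omega> * (Z m \<omega>)\<^sup>2) + expectation T + 2 * \<sigma> * expectation S"
    using intZ intT intS by simp
  also have "\<dots> \<le> expectation Q + expectation T
      + 2 * \<sigma> * (- \<epsilon> * expectation (\<lambda>\<omega>. W \<omega> * (Z k \<omega> - real n * (\<sigma> * \<beta>))))"
  proof -
    have "expectation (\<lambda>\<omega>. W \<omega> * (Z m \<omega>)\<^sup>2) \<le> expectation Q"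
      using Suc.IH unfolding m_def Q_def a_def .
    moreover have "2 * \<sigma> * expectation S
        \<le> 2 * \<sigma> * (- \<epsilon> * expectation (\<lambda>\<omega>. W \<omega> * (Z k \<omega> - real n * (\<sigma> * \<beta>))))"
      using pos by (intro mult_left_mono ES) auto
    ultimately show ?thesis by linarith
  qed
  also have "\<dots> = expectation (\<lambda>\<omega>. Q \<omega> + T \<omega> - 2 * \<sigma> * \<epsilon> * (W \<omega> * (Z k \<omega> - real n * (\<sigma> * \<beta>))))"
    using intQ intT intV by simp
  also have "\<dots> = expectation (\<lambda>\<omega>. W \<omega> * ((Z k \<omega>)\<^sup>2
      + real (Suc n) * a + \<sigma> * \<alpha> * (d w k \<omega> - d w (k + Suc n) \<omega>)
      - 2 * \<sigma> * \<epsilon> * (real (Suc n) * Z k \<omega>) + \<sigma>\<^sup>2 * \<epsilon> * \<beta> * (real (Suc n) * (real (Suc n) - 1))))"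
    by (rule Bochner_Integration.integral_cong)
       (simp_all add: Q_def T_def m_def algebra_simps power2_eq_square)
  finally show ?case unfolding a_def .
qed

text \<open>Chosen so that above it half of the gain
  \<open>2 * \<sigma> * \<epsilon> * s * Z\<close> pays for every positive term of
  \<open>weighted_energy\<close>, while the other half survives as drift. The first summand equals
  the intended decrease over \<open>s\<close> steps.\<close>

definition \<theta> :: "real \<Rightarrow> nat \<Rightarrow> real" where
  "\<theta> \<epsilon> s = \<epsilon> * \<sigma> * real s / 2 + \<sigma> * \<beta> * (real s - 1) + \<alpha> * R\<^sup>2 / (\<epsilon> * real s)
    + 2 * \<kappa>f * R / \<epsilon> + \<sigma> * \<nu>g\<^sup>2 / \<epsilon>"

lemma drift:
  fixes \<epsilon> :: real
  assumes w: "w \<in> C" and \<epsilon>: "\<epsilon> > 0" "\<And>i. i \<in> {1..p} \<Longrightarrow> (\<integral>z. G i w z \<partial>\<mu>) \<le> - \<epsilon>"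
    and W: "W \<in> borel_measurable (hist k)" "ess_bounded W" "\<And>\<omega>. 0 \<le> W \<omega>"
      "\<And>\<omega>. Z k \<omega> < \<theta> \<epsilon> s \<Longrightarrow> W \<omega> = 0"
    and s: "s > 0" and \<nu>g: "\<nu>g > 0"
  shows "expectation (\<lambda>\<omega>. W \<omega> * (Z (k + s) \<omega> - Z k \<omega>)) \<le> - (real s * (\<sigma> * \<epsilon> / 2)) * expectation W"
proof -
  define e where "e = real s * (\<sigma> * \<epsilon> / 2)"
  \<comment> \<open>The intended value \<open>Z k - e\<close> after the window. The maximum changes
    it only where \<open>W\<close> vanishes and keeps it bounded away from 0, so that dividing by it
    is safe.\<close>
  define c where "c = (\<lambda>\<omega>. max (Z k \<omega>) (\<theta> \<epsilon> s) - e)"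
  have \<theta>e: "\<theta> \<epsilon> s - e > 0"
  proof -
    have "0 \<le> \<sigma> * \<beta> * (real s - 1)" "0 \<le> \<alpha> * R\<^sup>2 / (\<epsilon> * real s)" "0 \<le> 2 * \<kappa>f * R / \<epsilon>" "0 < \<sigma> * \<nu>g\<^sup>2 / \<epsilon>"
      using pos s \<epsilon> \<nu>g \<beta>_nonneg \<kappa>f_nonneg R_nonneg by auto
    then show ?thesis by (simp add: \<theta>_def e_def)
  qed
  have c: "c \<omega> \<ge> \<theta> \<epsilon> s - e" "c \<omega> > 0" for \<omega>
    using \<theta>e by (auto simp: c_def)
  have c_eq: "W \<omega> * c \<omega> = W \<omega> * (Z k \<omega> - e)" for \<omega>
    using W(4)[of \<omega>] by (cases "Z k \<omega> < \<theta> \<epsilon> s") (auto simp: c_def)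
  \<comment> \<open>\<open>weighted_energy\<close> controls \<open>Z\<^sup>2\<close>; reweighting it by \<open>1 / (2 c)\<close> and using \<open>2 c Z \<le> Z\<^sup>2 + c\<^sup>2\<close>
    gives the bound for \<open>Z\<close> itself without a conditional Jensen inequality\<close>
  define V where "V = (\<lambda>\<omega>. W \<omega> / (2 * c \<omega>))"
  have c_meas: "c \<in> borel_measurable (hist k)"
    unfolding c_def using Z_hist by measurable
  have V_meas: "V \<in> borel_measurable (hist k)"
    unfolding V_def using W(1) c_meas by measurable
  have "ess_bounded (\<lambda>\<omega>. 1 / (2 * c \<omega>))"
  proof (rule ess_boundedI)
    show "(\<lambda>\<omega>. 1 / (2 * c \<omega>)) \<in> borel_measurable M"
      using measurable_hist[OF c_meas] by measurable
    have "\<bar>1 / (2 * c \<omega>)\<bar> \<le> 1 / (2 * (\<theta> \<epsilon> s - e))" for \<omega>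
      using c[of \<omega>] \<theta>e by (simp add: abs_of_pos frac_le)
    then show "AE \<omega> in M. \<bar>1 / (2 * c \<omega>)\<bar> \<le> 1 / (2 * (\<theta> \<epsilon> s - e))" by simp
  qed
  from ess_bounded_mult[OF W(2) this] have V_bdd: "ess_bounded V"
    by (simp add: V_def)
  have V_nonneg: "0 \<le> V \<omega>" for \<omega>
    using W(3)[of \<omega>] c(2)[of \<omega>] by (simp add: V_def)
  have Vc: "2 * c \<omega> * V \<omega> = W \<omega>" for \<omega>
    using c(2)[of \<omega>] by (simp add: V_def)
  have "ess_bounded c"
  proof -
    obtain b where b: "AE \<omega> in M. \<bar>Z k \<omega>\<bar> \<le> b"
      using ess_bounded_Z unfolding ess_bounded_def by blast
    show ?thesis
    proof (rule ess_boundedI)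
      show "c \<in> borel_measurable M" by (rule measurable_hist[OF c_meas])
      show "AE \<omega> in M. \<bar>c \<omega>\<bar> \<le> b + \<bar>\<theta> \<epsilon> s\<bar> + \<bar>e\<bar>"
        using b by eventually_elim (auto simp: c_def max_def)
    qed
  qed
  note bdd = ess_bounded_intros W(2) V_bdd this ess_bounded_Z ess_bounded_d[OF w]
  have "expectation (\<lambda>\<omega>. V \<omega> * (Z (k + s) \<omega>)\<^sup>2) \<le> expectation (\<lambda>\<omega>. V \<omega> * ((Z k \<omega>)\<^sup>2
      + real s * (2 * \<sigma> * \<kappa>f * R + \<sigma>\<^sup>2 * \<nu>g\<^sup>2) + \<sigma> * \<alpha> * (d w k \<omega> - d w (k + s) \<omega>)
      - 2 * \<sigma> * \<epsilon> * (real s * Z k \<omega>) + \<sigma>\<^sup>2 * \<epsilon> * \<beta> * (real s * (real s - 1))))"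
    using \<epsilon> by (intro weighted_energy w V_meas V_bdd V_nonneg) auto
  also have "\<dots> \<le> expectation (\<lambda>\<omega>. V \<omega> * (c \<omega>)\<^sup>2)"
  proof (intro integral_mono ess_bounded_integrable bdd)
    fix \<omega>
    show "V \<omega> * ((Z k \<omega>)\<^sup>2
      + real s * (2 * \<sigma> * \<kappa>f * R + \<sigma>\<^sup>2 * \<nu>g\<^sup>2) + \<sigma> * \<alpha> * (d w k \<omega> - d w (k + s) \<omega>)
      - 2 * \<sigma> * \<epsilon> * (real s * Z k \<omega>) + \<sigma>\<^sup>2 * \<epsilon> * \<beta> * (real s * (real s - 1))) \<le> V \<omega> * (c \<omega>)\<^sup>2"
    proof (cases "Z k \<omega> < \<theta> \<epsilon> s")
      case True
      then show ?thesis using W(4) by (simp add: V_def)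
    next
      case False
      then have cz: "c \<omega> = Z k \<omega> - e" by (simp add: c_def)
      \<comment> \<open>Half of the gain is bounded below by its value at the threshold; the other
        half is the cross term of \<open>(Z k - e)^2\<close>.\<close>
      have "\<sigma> * \<epsilon> * real s * \<theta> \<epsilon> s \<le> \<sigma> * \<epsilon> * real s * Z k \<omega>"
        using False pos \<epsilon> by (intro mult_left_mono) auto
      moreover have "\<sigma> * \<epsilon> * real s * \<theta> \<epsilon> s = 2 * e\<^sup>2 + \<sigma>\<^sup>2 * \<epsilon> * \<beta> * (real s * (real s - 1))
          + \<sigma> * \<alpha> * R\<^sup>2 + real s * (2 * \<sigma> * \<kappa>f * R + \<sigma>\<^sup>2 * \<nu>g\<^sup>2)"
        using \<epsilon> s by (simp add: \<theta>_def e_def field_simps power2_eq_square)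
      moreover have "\<sigma> * \<alpha> * (d w k \<omega> - d w (k + s) \<omega>) \<le> \<sigma> * \<alpha> * R\<^sup>2"
        using pos d_bounds[OF w, of k \<omega>] d_bounds[OF w, of "k + s" \<omega>] by (intro mult_left_mono) auto
      moreover have "(c \<omega>)\<^sup>2 = (Z k \<omega>)\<^sup>2 - \<sigma> * \<epsilon> * real s * Z k \<omega> + e\<^sup>2"
        unfolding cz by (simp add: e_def power2_eq_square algebra_simps)
      moreover have "2 * \<sigma> * \<epsilon> * (real s * Z k \<omega>) = 2 * (\<sigma> * \<epsilon> * real s * Z k \<omega>)"
        by simp
      moreover have "0 \<le> e\<^sup>2" by simp
      ultimately show ?thesis
        by (intro mult_left_mono V_nonneg) linarith
    qed
  qed
  finally have main: "expectation (\<lambda>\<omega>. V \<omega> * (Z (k + s) \<omega>)\<^sup>2) \<le> expectation (\<lambda>\<omega>. V \<omega> * (c \<omega>)\<^sup>2)" .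
  have int: "integrable M (\<lambda>\<omega>. V \<omega> * (Z (k + s) \<omega>)\<^sup>2)" "integrable M (\<lambda>\<omega>. V \<omega> * (c \<omega>)\<^sup>2)"
      "integrable M (\<lambda>\<omega>. W \<omega> * Z k \<omega>)" "integrable M W" "integrable M (\<lambda>\<omega>. W \<omega> * (Z (k + s) \<omega> - Z k \<omega>))"
    by (intro ess_bounded_integrable bdd)+
  have "expectation (\<lambda>\<omega>. W \<omega> * (Z (k + s) \<omega> - Z k \<omega>))
      \<le> expectation (\<lambda>\<omega>. V \<omega> * (Z (k + s) \<omega>)\<^sup>2 + V \<omega> * (c \<omega>)\<^sup>2 - W \<omega> * Z k \<omega>)"
  proof (rule integral_mono)
    fix \<omega>
    have "0 \<le> V \<omega> * (Z (k + s) \<omega> - c \<omega>)\<^sup>2"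
      using V_nonneg by simp
    also have "\<dots> = V \<omega> * (Z (k + s) \<omega>)\<^sup>2 + V \<omega> * (c \<omega>)\<^sup>2 - (2 * c \<omega> * V \<omega>) * Z (k + s) \<omega>"
      by (simp add: power2_eq_square algebra_simps)
    finally show "W \<omega> * (Z (k + s) \<omega> - Z k \<omega>) \<le> V \<omega> * (Z (k + s) \<omega>)\<^sup>2 + V \<omega> * (c \<omega>)\<^sup>2 - W \<omega> * Z k \<omega>"
      unfolding Vc by (simp add: algebra_simps)
  qed (use int in auto)
  also have "\<dots> = expectation (\<lambda>\<omega>. V \<omega> * (Z (k + s) \<omega>)\<^sup>2) + expectation (\<lambda>\<omega>. V \<omega> * (c \<omega>)\<^sup>2)
      - expectation (\<lambda>\<omega>. W \<omega> * Z k \<omega>)"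
    using int by simp
  also have "\<dots> \<le> 2 * expectation (\<lambda>\<omega>. V \<omega> * (c \<omega>)\<^sup>2) - expectation (\<lambda>\<omega>. W \<omega> * Z k \<omega>)"
    using main by simp
  also have "\<dots> = expectation (\<lambda>\<omega>. 2 * (V \<omega> * (c \<omega>)\<^sup>2) - W \<omega> * Z k \<omega>)"
    using int by simp
  also have "\<dots> = expectation (\<lambda>\<omega>. - e * W \<omega>)"
  proof (rule Bochner_Integration.integral_cong)
    fix \<omega>
    have "2 * (V \<omega> * (c \<omega>)\<^sup>2) = (2 * c \<omega> * V \<omega>) * c \<omega>"
      by (simp add: power2_eq_square)
    then show "2 * (V \<omega> * (c \<omega>)\<^sup>2) - W \<omega> * Z k \<omega> = - e * W \<omega>"
      unfolding Vc c_eq by (simp add: algebra_simps)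
  qed simp
  also have "\<dots> = - e * expectation W"
    by simp
  finally show ?thesis by (simp add: e_def)
qed

text \<open>Chernoff's bound on the drift estimate with \<open>\<delta> = \<sigma> * \<beta>\<close>
  and \<open>\<zeta> = \<sigma> * \<epsilon> / 2\<close>. Then
  \<open>1 / r = s * (8 * \<sigma> * \<beta>^2 / \<epsilon>)\<close>, and the logarithm cancels the
  prefactor \<open>8 * \<delta>^2 / \<zeta>^2 = 32 * \<beta>^2 / \<epsilon>^2\<close>.\<close>

lemma Z_tail:
  fixes \<epsilon> u :: real
  assumes w: "w \<in> C" and \<epsilon>: "\<epsilon> > 0" "\<And>i. i \<in> {1..p} \<Longrightarrow> (\<integral>z. G i w z \<partial>\<mu>) \<le> - \<epsilon>"
    and s: "s > 0" and \<nu>g: "\<nu>g > 0" and \<epsilon>\<beta>: "\<epsilon> \<le> 2 * \<beta>"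
  shows "prob {\<omega> \<in> space M. Z k \<omega> \<ge> \<theta> \<epsilon> s + real s * (\<sigma> * \<beta>)
      + real s * (8 * \<sigma> * \<beta>\<^sup>2 / \<epsilon>) * (ln (32 * \<beta>\<^sup>2 / \<epsilon>\<^sup>2) + u)} \<le> exp (- u)"
proof -
  define \<delta> \<zeta> where "\<delta> = \<sigma> * \<beta>" and "\<zeta> = \<sigma> * \<epsilon> / 2"
  define r where "r = \<zeta> / (4 * real s * \<delta>\<^sup>2)"
  define z where "z = \<theta> \<epsilon> s + real s * \<delta> + real s * (8 * \<sigma> * \<beta>\<^sup>2 / \<epsilon>) * (ln (32 * \<beta>\<^sup>2 / \<epsilon>\<^sup>2) + u)"
  have \<beta>: "\<beta> > 0" using \<epsilon> \<epsilon>\<beta> by linarith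
  have \<zeta>: "0 < \<zeta>" "\<zeta> \<le> \<delta>"
    using \<epsilon> pos \<epsilon>\<beta> mult_left_mono[of \<epsilon> "2 * \<beta>" \<sigma>] by (auto simp: \<zeta>_def \<delta>_def)
  have r: "r > 0"
    using \<zeta> s by (simp add: r_def)
  have \<theta>: "0 \<le> \<theta> \<epsilon> s"
    unfolding \<theta>_def using \<epsilon> pos s \<beta> R_nonneg \<kappa>f_nonneg by (intro add_nonneg_nonneg) auto
  have inc: "AE \<omega> in M. \<forall>k. \<bar>Z (Suc k) \<omega> - Z k \<omega>\<bar> \<le> \<delta>"
    using AE_sample by eventually_elim (auto simp: \<delta>_def intro: Z_increment)
  note exp_moment = drift_exp_moment[where Z = Z and \<theta> = "\<theta> \<epsilon> s" and \<delta> = \<delta> and \<zeta> = \<zeta> and s = s and r = r,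
      OF Z_hist Z_0 inc _ \<zeta> s \<theta> r_def]
  have dr: "\<And>k W. W \<in> borel_measurable (hist k) \<Longrightarrow> ess_bounded W \<Longrightarrow> (\<And>\<omega>. 0 \<le> W \<omega>) \<Longrightarrow>
       (\<And>\<omega>. Z k \<omega> < \<theta> \<epsilon> s \<Longrightarrow> W \<omega> = 0) \<Longrightarrow>
       expectation (\<lambda>\<omega>. W \<omega> * (Z (k + s) \<omega> - Z k \<omega>)) \<le> - (real s * \<zeta>) * expectation W"
    unfolding \<zeta>_def by (rule drift[OF w \<epsilon> _ _ _ _ s \<nu>g])
  have bdd: "ess_bounded (\<lambda>\<omega>. exp (r * Z k \<omega>))"
    by (rule exp_moment(1)[OF dr])
  have "(\<integral>\<^sup>+\<omega>. ennreal (exp (r * Z k \<omega>)) \<partial>M) = ennreal (expectation (\<lambda>\<omega>. exp (r * Z k \<omega>)))"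
    by (intro nn_integral_eq_integral ess_bounded_integrable bdd) auto
  also have "\<dots> \<le> ennreal (exp (r * (\<theta> \<epsilon> s + real s * \<delta>)) * (8 * \<delta>\<^sup>2 / \<zeta>\<^sup>2))"
    by (intro ennreal_leI exp_moment(2)[OF dr])
  finally have "prob {\<omega> \<in> space M. Z k \<omega> \<ge> z}
      \<le> exp (- r * z) * (exp (r * (\<theta> \<epsilon> s + real s * \<delta>)) * (8 * \<delta>\<^sup>2 / \<zeta>\<^sup>2))"
    using r by (intro prob_Chernoff) auto
  also have "8 * \<delta>\<^sup>2 / \<zeta>\<^sup>2 = exp (ln (32 * \<beta>\<^sup>2 / \<epsilon>\<^sup>2))"
  proof -
    have "8 * \<delta>\<^sup>2 / \<zeta>\<^sup>2 = 32 * \<beta>\<^sup>2 / \<epsilon>\<^sup>2"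
      using pos by (simp add: \<delta>_def \<zeta>_def power_mult_distrib power_divide)
    moreover have "32 * \<beta>\<^sup>2 / \<epsilon>\<^sup>2 > 0" using \<beta> \<epsilon> by simp
    ultimately show ?thesis by simp
  qed
  also have "exp (- r * z) * (exp (r * (\<theta> \<epsilon> s + real s * \<delta>)) * exp (ln (32 * \<beta>\<^sup>2 / \<epsilon>\<^sup>2))) = exp (- u)"
  proof -
    have "r * (real s * (8 * \<sigma> * \<beta>\<^sup>2 / \<epsilon>)) = 1"
      using \<epsilon> \<beta> pos s by (simp add: r_def \<zeta>_def \<delta>_def power_mult_distrib) (simp add: power2_eq_square)
    then have "r * z = r * (\<theta> \<epsilon> s + real s * \<delta>) + (ln (32 * \<beta>\<^sup>2 / \<epsilon>\<^sup>2) + u)"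
      unfolding z_def distrib_left[of r] mult.assoc[symmetric] by (simp only: mult.assoc mult_1_left)
    then show ?thesis
      by (simp add: exp_add[symmetric])
  qed
  finally show ?thesis by (simp add: z_def \<delta>_def)
qed

end

context slpmm_process
begin

subsection \<open>Concentration of the noise terms\<close>

lemma measure_\<mu>_UNIV [simp]: "measure \<mu> UNIV = 1"
  using prob_space.prob_space[OF prob_space_\<mu>] by simp

text \<open>The objective of the theorem is prescribed only on \<open>C\<close>; this total version
  is Borel measurable, which makes the events about it measurable.\<close>

definition fbar :: "'a \<Rightarrow> real" where "fbar x = (\<integral>z. F x z \<partial>\<mu>)"

lemma fbar_measurable [measurable]: "fbar \<in> borel_measurable borel"
proof -
  interpret \<mu>: prob_space \<mu> by (rule prob_space_\<mu>)
  have "(\<lambda>(x, z). F x z) \<in> borel_measurable (borel \<Otimes>\<^sub>M \<mu>)"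
    using F_meas by (simp add: borel_prod[symmetric] cong: measurable_cong_sets sets_pair_measure_cong)
  then show ?thesis
    unfolding fbar_def[abs_def] by (rule \<mu>.borel_measurable_lebesgue_integral)
qed

text \<open>The sign \<open>e\<close> and the moving point \<open>y k\<close> allow one statement
  for two uses: sign \<open>- 1\<close> along the iterates and sign \<open>1\<close> at a fixed
  comparison point.\<close>

lemma objective_noise_tail:
  fixes y :: "nat \<Rightarrow> 'w \<Rightarrow> 'a" and so e \<rho> :: real
  assumes y [measurable]: "\<And>k. y k \<in> borel_measurable (hist k)" and yC: "\<And>k \<omega>. y k \<omega> \<in> C"
    and e: "e\<^sup>2 = 1" and so: "so > 0"
    and subgauss: "\<And>x. x \<in> C \<Longrightarrow>
      (\<integral>\<^sup>+z. ennreal (exp (\<bar>F x z - fbar x\<bar>\<^sup>2 / so\<^sup>2)) \<partial>\<mu>) \<le> ennreal (exp 1)"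
    and \<rho>: "\<rho> > 0" and K: "K > 0"
  shows "prob {\<omega> \<in> space M. (\<Sum>k<K. e * (F (y k \<omega>) (\<xi> k \<omega>) - fbar (y k \<omega>))) \<ge> \<rho> * so * sqrt (real K)}
    \<le> exp (- \<rho>\<^sup>2 / 3)"
proof -
  interpret \<mu>: prob_space \<mu> by (rule prob_space_\<mu>)
  \<comment> \<open>Minimizes \<open>- t * \<rho> * so * sqrt K + 3/4 * K * t^2 * so^2\<close>, with
    value \<open>- \<rho>^2 / 3\<close>.\<close>
  define t where "t = 2 * \<rho> / (3 * so * sqrt (real K))"
  define c where "c = 3 / 4 * t\<^sup>2 * so\<^sup>2"
  have t: "t > 0" using \<rho> so K by (simp add: t_def)
  let ?h = "\<lambda>k \<omega> z. t * (e * (F (y k \<omega>) z - fbar (y k \<omega>)))"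
  let ?S = "\<lambda>\<omega>. \<Sum>k<K. e * (F (y k \<omega>) (\<xi> k \<omega>) - fbar (y k \<omega>))"
  have "(\<integral>\<^sup>+\<omega>. ennreal (exp (\<Sum>k<K. ?h k \<omega> (\<xi> k \<omega>))) \<partial>M) \<le> ennreal (exp (real K * c))"
  proof (rule nn_integral_exp_sum_le)
    fix k
    show "(\<lambda>(\<omega>, z). ?h k \<omega> z) \<in> borel_measurable (hist k \<Otimes>\<^sub>M borel)"
      by measurable
  next
    fix k \<omega>
    let ?x = "y k \<omega>"
    have "(\<integral>\<^sup>+z. ennreal (exp ((t * e) * (F ?x z - fbar ?x))) \<partial>\<mu>) \<le> ennreal (exp (3 / 4 * (t * e)\<^sup>2 * so\<^sup>2))"
      using F_int[OF yC] so subgauss[OF yC]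
      by (intro \<mu>.nn_integral_exp_subgaussian) (auto simp: fbar_def \<mu>.prob_space)
    then show "(\<integral>\<^sup>+z. ennreal (exp (?h k \<omega> z)) \<partial>\<mu>) \<le> ennreal (exp c)"
      by (simp add: c_def power_mult_distrib e mult.assoc)
  qed
  then have "(\<integral>\<^sup>+\<omega>. ennreal (exp (t * ?S \<omega>)) \<partial>M) \<le> ennreal (exp (real K * c))"
    by (simp add: sum_distrib_left)
  moreover have "?S \<in> borel_measurable M"
    using measurable_hist[OF y] by measurable
  ultimately have "prob {\<omega> \<in> space M. ?S \<omega> \<ge> \<rho> * so * sqrt (real K)}
      \<le> exp (- t * (\<rho> * so * sqrt (real K))) * exp (real K * c)"
    by (intro prob_Chernoff t) auto
  also have "\<dots> = exp (- t * (\<rho> * so * sqrt (real K)) + real K * c)"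
    by (rule exp_add[symmetric])
  also have "- t * (\<rho> * so * sqrt (real K)) = - 2 * \<rho>\<^sup>2 / 3"
    using so K by (simp add: t_def power2_eq_square)
  also have "real K * c = \<rho>\<^sup>2 / 3"
    using so K by (simp add: c_def t_def power_divide power_mult_distrib)
  finally show ?thesis by simp
qed

text \<open>Whether \<open>Z k \<le> B\<close> is known before sample \<open>k\<close> is drawn, so
  truncation preserves the nonpositive conditional mean. Cauchy-Schwarz bounds each truncated term
  by \<open>\<nu>g * B\<close>.\<close>

lemma multiplier_noise_tail:
  fixes B \<rho> :: real
  assumes w: "w \<in> C" "\<And>i. i \<in> {1..p} \<Longrightarrow> (\<integral>z. G i w z \<partial>\<mu>) \<le> 0"
    and pos': "\<nu>g > 0" "B > 0" and \<rho>: "\<rho> > 0" and K: "K > 0"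
  shows "prob {\<omega> \<in> space M.
      (\<Sum>k<K. if Z k \<omega> \<le> B then \<Sum>i=1..p. Lam k \<omega> i * G i w (\<xi> k \<omega>) else 0)
        \<ge> sqrt (2 * \<rho>) * sqrt (real K) * (\<nu>g * B)} \<le> exp (- \<rho>)"
proof -
  interpret \<mu>: prob_space \<mu> by (rule prob_space_\<mu>)
  define c where "c = \<nu>g * B"
  \<comment> \<open>Minimizes
    \<open>- t * sqrt (2 * \<rho>) * sqrt K * c + K * t^2 * c^2 / 2\<close>, with value
    \<open>- \<rho>\<close>.\<close>
  define t where "t = sqrt (2 * \<rho>) / (sqrt (real K) * c)"
  have c: "c > 0" using pos' by (simp add: c_def)
  have t: "t > 0" using \<rho> c K by (simp add: t_def)
  let ?D = "\<lambda>k \<omega> z. if Z k \<omega> \<le> B then \<Sum>i=1..p. Lam k \<omega> i * G i w z else 0"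
  let ?S = "\<lambda>\<omega>. \<Sum>k<K. ?D k \<omega> (\<xi> k \<omega>)"
  have "(\<integral>\<^sup>+\<omega>. ennreal (exp (\<Sum>k<K. t * ?D k \<omega> (\<xi> k \<omega>))) \<partial>M) \<le> ennreal (exp (real K * (t\<^sup>2 * c\<^sup>2 / 2)))"
  proof (rule nn_integral_exp_sum_le)
    fix k
    note [measurable] = Lam_hist[of k] Z_hist[of k]
    show "(\<lambda>(\<omega>, z). t * ?D k \<omega> z) \<in> borel_measurable (hist k \<Otimes>\<^sub>M borel)"
      by measurable
  next
    fix k \<omega>
    have "AE z in \<mu>. \<bar>?D k \<omega> z\<bar> \<le> c"
      using supp
    proof eventually_elim
      case (elim z)
      show ?case
      proof (cases "Z k \<omega> \<le> B")
        case True
        have "\<bar>\<Sum>i=1..p. Lam k \<omega> i * G i w z\<bar> \<le> (\<Sum>i=1..p. \<bar>Lam k \<omega> i\<bar> * \<bar>G i w z\<bar>)"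
          by (rule order_trans[OF sum_abs]) (simp add: abs_mult)
        also have "\<dots> \<le> L2_set (Lam k \<omega>) {1..p} * L2_set (\<lambda>i. G i w z) {1..p}"
          by (rule L2_set_mult_ineq)
        also have "\<dots> \<le> B * \<nu>g"
          using True[unfolded Z_def] G_bound[OF w(1) elim] pos' by (intro mult_mono) auto
        finally show ?thesis using True by (simp add: c_def mult.commute)
      qed (use c in simp)
    qed
    moreover have "(\<integral>z. ?D k \<omega> z \<partial>\<mu>) \<le> 0"
    proof (cases "Z k \<omega> \<le> B")
      case True
      have "(\<integral>z. ?D k \<omega> z \<partial>\<mu>) = (\<Sum>i=1..p. Lam k \<omega> i * (\<integral>z. G i w z \<partial>\<mu>))"
        using True G_int[OF _ w(1)] by (simp add: Bochner_Integration.integral_sum)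
      also have "\<dots> \<le> 0"
        by (intro sum_nonpos mult_nonneg_nonpos w Lam_nonneg)
      finally show ?thesis .
    qed simp
    ultimately show "(\<integral>\<^sup>+z. ennreal (exp (t * ?D k \<omega> z)) \<partial>\<mu>) \<le> ennreal (exp (t\<^sup>2 * c\<^sup>2 / 2))"
      by (intro \<mu>.nn_integral_exp_bounded t) measurable
  qed
  then have "(\<integral>\<^sup>+\<omega>. ennreal (exp (t * ?S \<omega>)) \<partial>M) \<le> ennreal (exp (real K * (t\<^sup>2 * c\<^sup>2 / 2)))"
    by (simp add: sum_distrib_left)
  moreover have "?S \<in> borel_measurable M"
    by measurable
  ultimately have "prob {\<omega> \<in> space M. ?S \<omega> \<ge> sqrt (2 * \<rho>) * sqrt (real K) * c}
      \<le> exp (- t * (sqrt (2 * \<rho>) * sqrt (real K) * c)) * exp (real K * (t\<^sup>2 * c\<^sup>2 / 2))"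
    by (intro prob_Chernoff t) auto
  also have "\<dots> = exp (- t * (sqrt (2 * \<rho>) * sqrt (real K) * c) + real K * (t\<^sup>2 * c\<^sup>2 / 2))"
    by (rule exp_add[symmetric])
  also have "- t * (sqrt (2 * \<rho>) * sqrt (real K) * c) = - (2 * \<rho>)"
    using c K \<rho> by (simp add: t_def)
  also have "real K * (t\<^sup>2 * c\<^sup>2 / 2) = \<rho>"
    using c K \<rho> by (simp add: t_def power_divide power_mult_distrib)
  finally show ?thesis by (simp add: c_def)
qed

subsection \<open>The objective gap\<close>

text \<open>A pathwise estimate. The induction keeps the squared multiplier norm and the distance on
  the left so that both telescope; they are dropped only at the end.\<close>

lemma objective_bound:
  assumes sample: "\<forall>k. \<xi> k \<omega> \<in> \<Xi>" and w: "w \<in> C"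
  shows "(\<Sum>k<n. F (X k \<omega>) (\<xi> k \<omega>) - F w (\<xi> k \<omega>))
    \<le> real n * (\<kappa>f\<^sup>2 / (2 * \<alpha>) + \<sigma> * \<nu>g\<^sup>2 / 2) + \<alpha> / 2 * R\<^sup>2
      + (\<Sum>k<n. \<Sum>i=1..p. Lam k \<omega> i * G i w (\<xi> k \<omega>))"
proof -
  have "(\<Sum>k<n. F (X k \<omega>) (\<xi> k \<omega>) - F w (\<xi> k \<omega>)) + (Z n \<omega>)\<^sup>2 / (2 * \<sigma>) + \<alpha> / 2 * d w n \<omega>
    \<le> real n * (\<kappa>f\<^sup>2 / (2 * \<alpha>) + \<sigma> * \<nu>g\<^sup>2 / 2) + \<alpha> / 2 * d w 0 \<omega>
      + (\<Sum>k<n. \<Sum>i=1..p. Lam k \<omega> i * G i w (\<xi> k \<omega>))"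
  proof (induction n)
    case 0
    then show ?case by (simp add: Z_0)
  next
    case (Suc n)
    define x x' z where "x = X n \<omega>" and "x' = X (Suc n) \<omega>" and "z = \<xi> n \<omega>"
    have z: "z \<in> \<Xi>" using sample by (simp add: z_def)
    have sub: "F x z + inner (v0 x z) (w - x) \<le> F w z"
      using v0_sub[OF X_in_C z, of n \<omega>] w by (simp add: is_subgrad_on_def x_def)
    \<comment> \<open>The proximal term absorbs the linear change of the objective by completing the
      square at step length \<open>\<kappa>f / \<alpha>\<close>.\<close>
    have "- (\<kappa>f\<^sup>2 / (2 * \<alpha>)) \<le> inner (v0 x z) (x' - x) + \<alpha> / 2 * (norm (x' - x))\<^sup>2"
    proof -
      define a where "a = norm (x' - x)"
      have "- inner (v0 x z) (x' - x) \<le> norm (v0 x z) * a"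
        unfolding a_def using norm_cauchy_schwarz[of "- v0 x z" "x' - x"] by simp
      also have "\<dots> \<le> \<kappa>f * a"
        unfolding a_def using v0_bound[OF X_in_C z, of n \<omega>] by (intro mult_right_mono) (auto simp: x_def)
      also have "\<dots> = \<kappa>f\<^sup>2 / (2 * \<alpha>) + \<alpha> / 2 * a\<^sup>2 - \<alpha> / 2 * (a - \<kappa>f / \<alpha>)\<^sup>2"
        using pos by (simp add: power2_eq_square field_simps)
      also have "\<dots> \<le> \<kappa>f\<^sup>2 / (2 * \<alpha>) + \<alpha> / 2 * a\<^sup>2"
        using pos by simp
      finally show ?thesis by (simp add: a_def)
    qed
    then have "F x z - F w z + ((Z (Suc n) \<omega>)\<^sup>2 - (Z n \<omega>)\<^sup>2) / (2 * \<sigma>) + \<alpha> / 2 * d w (Suc n) \<omega>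
      \<le> \<kappa>f\<^sup>2 / (2 * \<alpha>) + \<sigma> * \<nu>g\<^sup>2 / 2 + (\<Sum>i=1..p. Lam n \<omega> i * G i w z) + \<alpha> / 2 * d w n \<omega>"
      using process_basic[OF sample[rule_format, of n] w] sub
      unfolding d_def x_def[symmetric] x'_def[symmetric] z_def[symmetric] by linarith
    moreover have "real (Suc n) * c = real n * c + c" for c
      by (simp add: algebra_simps)
    note this[of "\<kappa>f\<^sup>2 / (2 * \<alpha>) + \<sigma> * \<nu>g\<^sup>2 / 2"]
    ultimately show ?case
      using Suc unfolding sum.lessThan_Suc diff_divide_distrib x_def z_def by linarith
  qed
  moreover have "0 \<le> (Z n \<omega>)\<^sup>2 / (2 * \<sigma>)" "0 \<le> \<alpha> / 2 * d w n \<omega>"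
    using pos d_bounds[OF w] by auto
  moreover have "\<alpha> / 2 * d w 0 \<omega> \<le> \<alpha> / 2 * R\<^sup>2"
    using pos d_bounds[OF w] by (intro mult_left_mono) auto
  ultimately show ?thesis by linarith
qed

lemma convex_on_fbar:
  assumes "\<And>z. z \<in> \<Xi> \<Longrightarrow> convex_on C (\<lambda>x. F x z)"
  shows "convex_on C fbar"
proof (rule convex_onI)
  fix t :: real and x y assume t: "0 < t" "t < 1" and xy: "x \<in> C" "y \<in> C"
  have xyC: "(1 - t) *\<^sub>R x + t *\<^sub>R y \<in> C"
    using C(3) xy t by (intro convexD_alt) auto
  have "fbar ((1 - t) *\<^sub>R x + t *\<^sub>R y) \<le> (\<integral>z. (1 - t) * F x z + t * F y z \<partial>\<mu>)"
    unfolding fbar_def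
  proof (rule integral_mono_AE)
    show "AE z in \<mu>. F ((1 - t) *\<^sub>R x + t *\<^sub>R y) z \<le> (1 - t) * F x z + t * F y z"
      using supp by eventually_elim (use convex_onD[OF assms] t xy in auto)
  qed (use F_int xy xyC in auto)
  also have "\<dots> = (1 - t) * fbar x + t * fbar y"
    unfolding fbar_def using F_int xy by simp
  finally show "fbar ((1 - t) *\<^sub>R x + t *\<^sub>R y) \<le> (1 - t) * fbar x + t * fbar y" .
qed (rule C(3))

section \<open>The explicit multiplier level\<close>

definition \<kappa>3 :: "real \<Rightarrow> real" where
  "\<kappa>3 \<epsilon> = 2 * \<beta> + \<epsilon> / 2 + 8 * \<beta>\<^sup>2 / \<epsilon> * ln (32 * \<beta>\<^sup>2 / \<epsilon>\<^sup>2)"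

text \<open>Equals \<open>sqrt K\<close> times the bracket that multiplies
  \<open>sqrt (2 * \<rho>) * \<nu>g\<close> in the final bound.\<close>

definition Zbound :: "real \<Rightarrow> nat \<Rightarrow> real \<Rightarrow> real" where
  "Zbound \<epsilon> K \<rho> = (2 * \<kappa>f * R / \<epsilon> + R\<^sup>2 / \<epsilon> + 2 * \<kappa>3 \<epsilon>) + 16 * \<beta>\<^sup>2 / \<epsilon> * (\<rho> + ln (real K))
    + (\<nu>g\<^sup>2 / \<epsilon> - \<beta>) / sqrt (real K)"

text \<open>Without constraints \<open>\<beta>\<close> may be small compared with \<open>\<epsilon>\<close>, so that the logarithm in \<open>\<kappa>3\<close> is negative;
  \<open>u ln u \<ge> u - 1\<close> controls it.\<close>
lemma Zbound_nonneg:
  assumes \<epsilon>: "\<epsilon> > 0" and "K \<ge> 1" "\<rho> \<ge> 0"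
  shows "0 \<le> Zbound \<epsilon> K \<rho>"
proof -
  define u where "u = 32 * \<beta>\<^sup>2 / \<epsilon>\<^sup>2"
  have "- 1 \<le> u * ln u"
  proof (cases "u > 0")
    case True
    have "ln (inverse u) \<le> inverse u - 1"
      using True by (intro ln_le_minus_one) auto
    then have "u * (1 - inverse u) \<le> u * ln u"
      using True by (intro mult_left_mono) (auto simp: ln_inverse)
    then have "u - 1 \<le> u * ln u"
      using True by (simp add: algebra_simps)
    then show ?thesis using True by linarith
  next
    case False
    moreover have "0 \<le> u" by (simp add: u_def)
    ultimately have "u = 0" by linarith
    then show ?thesis by simp
  qed
  \<comment> \<open>The factor \<open>\<epsilon> / 4\<close> turns \<open>u\<close> into the
    coefficient \<open>8 * \<beta>^2 / \<epsilon>\<close>; the resulting loss is covered by the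
    summand \<open>\<epsilon> / 2\<close> of \<open>\<kappa>3\<close>.\<close>
  then have "\<epsilon> / 4 * (- 1) \<le> \<epsilon> / 4 * (u * ln u)"
    using \<epsilon> by (intro mult_left_mono) auto
  also have "\<dots> = 8 * \<beta>\<^sup>2 / \<epsilon> * ln u"
    using \<epsilon> by (simp add: u_def power2_eq_square)
  finally have "2 * \<beta> \<le> \<kappa>3 \<epsilon>"
    unfolding \<kappa>3_def u_def[symmetric] using \<epsilon> by linarith
  moreover have "- \<beta> \<le> (\<nu>g\<^sup>2 / \<epsilon> - \<beta>) / sqrt (real K)"
  proof -
    have "1 \<le> sqrt (real K)" using assms by simp
    then have "\<beta> / sqrt (real K) \<le> \<beta>"
      using \<beta>_nonneg mult_left_mono[of 1 "sqrt (real K)" \<beta>] by (simp add: divide_le_eq)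
    moreover have "0 \<le> \<nu>g\<^sup>2 / \<epsilon> / sqrt (real K)" using \<epsilon> by simp
    ultimately show ?thesis by (simp add: diff_divide_distrib)
  qed
  moreover have "0 \<le> 2 * \<kappa>f * R / \<epsilon>" "0 \<le> R\<^sup>2 / \<epsilon>" "0 \<le> 16 * \<beta>\<^sup>2 / \<epsilon> * (\<rho> + ln (real K))"
    using \<epsilon> \<kappa>f_nonneg R_nonneg assms by auto
  ultimately show ?thesis
    unfolding Zbound_def using \<beta>_nonneg by linarith
qed

text \<open>A single constraint forces this, since its values are almost surely at least
  \<open>- \<nu>g\<close>. It yields \<open>\<epsilon> \<le> \<beta>\<close>, hence a nonnegative
  logarithm in \<open>\<kappa>3\<close>.\<close>

lemma slater_le_\<nu>g:
  assumes w: "w \<in> C" and \<epsilon>: "\<And>i. i \<in> {1..p} \<Longrightarrow> (\<integral>z. G i w z \<partial>\<mu>) \<le> - \<epsilon>" and p: "p \<ge> 1"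
  shows "\<epsilon> \<le> \<nu>g"
proof -
  interpret \<mu>: prob_space \<mu> by (rule prob_space_\<mu>)
  have i: "p \<in> {1..p}" using p by simp
  have "(\<integral>z. - \<nu>g \<partial>\<mu>) \<le> (\<integral>z. G p w z \<partial>\<mu>)"
  proof (rule integral_mono_AE)
    show "AE z in \<mu>. - \<nu>g \<le> G p w z"
      using supp
    proof eventually_elim
      case (elim z)
      have "\<bar>G p w z\<bar> \<le> L2_set (\<lambda>i. \<bar>G i w z\<bar>) {1..p}"
        using i by (intro member_le_L2_set) auto
      also have "\<dots> = L2_set (\<lambda>i. G i w z) {1..p}"
        by (simp add: L2_set_def)
      also have "\<dots> \<le> \<nu>g" by (rule G_bound[OF w elim])
      finally show ?case by linarith
    qed
  qed (use G_int[OF i w] in auto)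
  with \<epsilon>[OF i] show ?thesis by (simp add: \<mu>.prob_space)
qed

lemma Z_tail_sqrt:
  assumes \<sigma>: "\<sigma> = 1 / sqrt (real K)" and \<alpha>: "\<alpha> = sqrt (real K)" and K: "K \<ge> 1" and \<rho>: "\<rho> > 0"
    and w: "w \<in> C" and \<epsilon>: "\<epsilon> > 0" "\<And>i. i \<in> {1..p} \<Longrightarrow> (\<integral>z. G i w z \<partial>\<mu>) \<le> - \<epsilon>" and p: "p \<ge> 1"
  shows "Zbound \<epsilon> K \<rho> > 0"
    and "prob {\<omega> \<in> space M. Z k \<omega> > Zbound \<epsilon> K \<rho>} \<le> exp (- \<rho>) / real K"
proof -
  have \<epsilon>\<nu>: "\<epsilon> \<le> \<nu>g" by (rule slater_le_\<nu>g[OF w \<epsilon>(2) p])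
  then have \<nu>g: "\<nu>g > 0" and \<beta>: "\<epsilon> \<le> \<beta>" "\<beta> > 0"
    using \<epsilon> \<nu>g_le_\<beta> by linarith+
  define q where "q = sqrt (real K)"
  have q: "1 \<le> q" using K by (simp add: q_def)
  \<comment> \<open>Balances the threshold: \<open>\<alpha> / s \<le> 1\<close> needs
    \<open>s\<close> at least \<open>sqrt K\<close>, while \<open>\<sigma> * s \<le> 2\<close> needs
    it at most \<open>2 * sqrt K\<close>.\<close>
  define s where "s = nat \<lceil>q\<rceil>"
  have s: "q \<le> real s" "real s \<le> 2 * q" "s > 0"
    using q unfolding s_def by linarith+
  define l where "l = ln (32 * \<beta>\<^sup>2 / \<epsilon>\<^sup>2)"
  have l: "0 \<le> l"
  proof -
    have "\<epsilon>\<^sup>2 \<le> \<beta>\<^sup>2" using \<beta> \<epsilon> by (intro power_mono) auto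
    then have "\<epsilon>\<^sup>2 \<le> 32 * \<beta>\<^sup>2" using zero_le_power2[of \<beta>] by linarith
    then show ?thesis unfolding l_def using \<epsilon> by (intro ln_ge_zero) simp
  qed
  define u where "u = \<rho> + ln (real K)"
  \<comment> \<open>The summand \<open>ln K\<close> in \<open>u\<close> provides the factor
    \<open>1 / K\<close> that a union bound over \<open>K\<close> steps consumes.\<close>
  have u: "0 \<le> u" using \<rho> K by (simp add: u_def)
  define B where "B = \<theta> \<epsilon> s + real s * (\<sigma> * \<beta>) + real s * (8 * \<sigma> * \<beta>\<^sup>2 / \<epsilon>) * (l + u)"
  have \<sigma>s: "\<sigma> * real s \<le> 2" and \<alpha>s: "\<alpha> / real s \<le> 1"
    using s q by (auto simp: \<sigma> \<alpha> q_def[symmetric] divide_le_eq)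
  have \<kappa>3: "0 \<le> \<kappa>3 \<epsilon>"
    unfolding \<kappa>3_def l_def[symmetric] using \<beta> \<epsilon> l by simp
  \<comment> \<open>The term \<open>- \<beta> * \<sigma>\<close> stems from the factor
    \<open>s - 1\<close> in \<open>\<theta>\<close>: together with
    \<open>s * \<sigma> * \<beta>\<close> it gives
    \<open>\<sigma> * \<beta> * (2 * s - 1)\<close>.\<close>
  have "B = (\<sigma> * real s) * \<kappa>3 \<epsilon> + (\<sigma> * real s) * (8 * \<beta>\<^sup>2 / \<epsilon> * u) + 2 * \<kappa>f * R / \<epsilon>
      + (\<alpha> / real s) * (R\<^sup>2 / \<epsilon>) + (\<nu>g\<^sup>2 / \<epsilon> - \<beta>) * \<sigma>"
    unfolding B_def \<theta>_def \<kappa>3_def l_def[symmetric] using \<epsilon> s by (simp add: field_simps)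
  also have "\<dots> \<le> 2 * \<kappa>3 \<epsilon> + 2 * (8 * \<beta>\<^sup>2 / \<epsilon> * u) + 2 * \<kappa>f * R / \<epsilon>
      + 1 * (R\<^sup>2 / \<epsilon>) + (\<nu>g\<^sup>2 / \<epsilon> - \<beta>) * \<sigma>"
    using \<sigma>s \<alpha>s \<kappa>3 u \<epsilon> by (intro add_mono mult_right_mono order_refl) auto
  also have "\<dots> = Zbound \<epsilon> K \<rho>"
    by (simp add: Zbound_def u_def \<sigma>)
  finally have B: "B \<le> Zbound \<epsilon> K \<rho>" .
  have "0 < \<theta> \<epsilon> s"
  proof -
    have "0 \<le> \<epsilon> * \<sigma> * real s / 2" "0 \<le> \<sigma> * \<beta> * (real s - 1)" "0 \<le> \<alpha> * R\<^sup>2 / (\<epsilon> * real s)"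
        "0 \<le> 2 * \<kappa>f * R / \<epsilon>" "0 < \<sigma> * \<nu>g\<^sup>2 / \<epsilon>"
      using pos s \<epsilon> \<nu>g \<beta> \<kappa>f_nonneg R_nonneg by auto
    then show ?thesis by (simp add: \<theta>_def)
  qed
  moreover have "0 \<le> real s * (\<sigma> * \<beta>)" "0 \<le> real s * (8 * \<sigma> * \<beta>\<^sup>2 / \<epsilon>) * (l + u)"
    using pos \<beta> \<epsilon> l u by auto
  ultimately have "0 < B" unfolding B_def by linarith
  with B show "Zbound \<epsilon> K \<rho> > 0" by linarith
  have "prob {\<omega> \<in> space M. Z k \<omega> > Zbound \<epsilon> K \<rho>} \<le> prob {\<omega> \<in> space M. Z k \<omega> \<ge> B}"
    using B by (intro finite_measure_mono) auto
  also have "\<dots> \<le> exp (- u)"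
    unfolding B_def l_def using \<beta> by (intro Z_tail[OF w \<epsilon> s(3) \<nu>g]) auto
  also have "\<dots> = exp (- \<rho>) * inverse (exp (ln (real K)))"
    unfolding u_def exp_minus[symmetric] exp_add[symmetric] by simp
  also have "\<dots> = exp (- \<rho>) / real K"
    using K by (simp add: divide_inverse)
  finally show "prob {\<omega> \<in> space M. Z k \<omega> > Zbound \<epsilon> K \<rho>} \<le> exp (- \<rho>) / real K" .
qed

lemma multiplier_term_bound:
  assumes \<sigma>: "\<sigma> = 1 / sqrt (real K)" and \<alpha>: "\<alpha> = sqrt (real K)" and K: "K \<ge> 1" and \<rho>: "\<rho> > 0"
    and w: "w \<in> C" and \<epsilon>: "\<epsilon> > 0" "\<And>i. i \<in> {1..p} \<Longrightarrow> (\<integral>z. G i w z \<partial>\<mu>) \<le> - \<epsilon>"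
    and y: "y \<in> C" "\<And>i. i \<in> {1..p} \<Longrightarrow> (\<integral>z. G i y z \<partial>\<mu>) \<le> 0"
  shows "prob {\<omega> \<in> space M. (\<Sum>k<K. \<Sum>i=1..p. Lam k \<omega> i * G i y (\<xi> k \<omega>))
      > sqrt (2 * \<rho>) * sqrt (real K) * (\<nu>g * Zbound \<epsilon> K \<rho>)} \<le> 2 * exp (- \<rho>)"
proof (cases "p \<ge> 1")
  case False
  \<comment> \<open>Without constraints the multiplier sum is empty, so the event is empty once the
    level is nonnegative.\<close>
  have "\<not> 0 > sqrt (2 * \<rho>) * sqrt (real K) * (\<nu>g * Zbound \<epsilon> K \<rho>)"
    using Zbound_nonneg[OF \<epsilon>(1) K, of \<rho>] \<rho> \<nu>g_nonneg by (simp add: not_less)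
  then show ?thesis using False by simp
next
  case True
  note Zt = Z_tail_sqrt[OF \<sigma> \<alpha> K \<rho> w \<epsilon> True]
  have \<nu>g: "\<nu>g > 0" using slater_le_\<nu>g[OF w \<epsilon>(2) True] \<epsilon>(1) by linarith
  define B where "B = Zbound \<epsilon> K \<rho>"
  define t where "t = sqrt (2 * \<rho>) * sqrt (real K) * (\<nu>g * B)"
  let ?D = "\<lambda>k \<omega>. \<Sum>i=1..p. Lam k \<omega> i * G i y (\<xi> k \<omega>)"
  define E where "E = {\<omega> \<in> space M. (\<Sum>k<K. if Z k \<omega> \<le> B then ?D k \<omega> else 0) \<ge> t}"
  define H where "H = (\<lambda>k. {\<omega> \<in> space M. Z k \<omega> > B})"
  have [measurable]: "E \<in> events" "H k \<in> events" for k
    unfolding E_def H_def by measurable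
  \<comment> \<open>Off the events \<open>H k\<close> truncation changes nothing; their union has
    probability at most \<open>K * (exp (- \<rho>) / K)\<close>.\<close>
  have "{\<omega> \<in> space M. (\<Sum>k<K. ?D k \<omega>) > t} \<subseteq> E \<union> (\<Union>k<K. H k)"
  proof
    fix \<omega> assume \<omega>: "\<omega> \<in> {\<omega> \<in> space M. (\<Sum>k<K. ?D k \<omega>) > t}"
    show "\<omega> \<in> E \<union> (\<Union>k<K. H k)"
    proof (cases "\<exists>k<K. Z k \<omega> > B")
      case False
      have "Z k \<omega> \<le> B" if "k < K" for k
        using False that by force
      then have "(\<Sum>k<K. if Z k \<omega> \<le> B then ?D k \<omega> else 0) = (\<Sum>k<K. ?D k \<omega>)"
        by (intro sum.cong) simp_all
      then show ?thesis using \<omega> by (simp add: E_def)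
    qed (use \<omega> in \<open>auto simp: H_def\<close>)
  qed
  then have "prob {\<omega> \<in> space M. (\<Sum>k<K. ?D k \<omega>) > t} \<le> prob (E \<union> (\<Union>k<K. H k))"
    by (intro finite_measure_mono) auto
  also have "\<dots> \<le> prob E + prob (\<Union>k<K. H k)"
    by (intro measure_Un_le) auto
  also have "\<dots> \<le> exp (- \<rho>) + exp (- \<rho>)"
  proof (rule add_mono)
    show "prob E \<le> exp (- \<rho>)"
      unfolding E_def t_def B_def using K by (intro multiplier_noise_tail y Zt \<nu>g \<rho>) auto
    have "prob (\<Union>k<K. H k) \<le> (\<Sum>k<K. prob (H k))"
      by (intro measure_UNION_le) auto
    also have "\<dots> \<le> (\<Sum>k<K. exp (- \<rho>) / real K)"
      unfolding H_def B_def by (intro sum_mono Zt)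
    finally show "prob (\<Union>k<K. H k) \<le> exp (- \<rho>)"
      using K by simp
  qed
  finally show ?thesis by (simp add: t_def B_def)
qed

theorem objective_gap_tail:
  assumes \<sigma>: "\<sigma> = 1 / sqrt (real K)" and \<alpha>: "\<alpha> = sqrt (real K)" and K: "K \<ge> 1" and \<rho>: "\<rho> > 0"
    and w: "w \<in> C" and \<epsilon>: "\<epsilon> > 0" "\<And>i. i \<in> {1..p} \<Longrightarrow> (\<integral>z. G i w z \<partial>\<mu>) \<le> - \<epsilon>"
    and y: "y \<in> C" "\<And>i. i \<in> {1..p} \<Longrightarrow> (\<integral>z. G i y z \<partial>\<mu>) \<le> 0"
    and so: "so > 0"
    and subgauss: "\<And>x. x \<in> C \<Longrightarrow>
      (\<integral>\<^sup>+z. ennreal (exp (\<bar>F x z - fbar x\<bar>\<^sup>2 / so\<^sup>2)) \<partial>\<mu>) \<le> ennreal (exp 1)"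
    and cvx: "\<And>z. z \<in> \<Xi> \<Longrightarrow> convex_on C (\<lambda>x. F x z)"
  shows "prob {\<omega> \<in> space M. fbar ((1 / real K) *\<^sub>R (\<Sum>k<K. X k \<omega>)) - fbar y
      \<le> sqrt (2 * \<rho>) * \<nu>g * (Zbound \<epsilon> K \<rho> / sqrt (real K)) + 2 * so * \<rho> / sqrt (real K)
        + (\<kappa>f\<^sup>2 + \<nu>g\<^sup>2 + R\<^sup>2) / 2 / sqrt (real K)} \<ge> 1 - 2 * exp (- \<rho>\<^sup>2 / 3) - 2 * exp (- \<rho>)"
proof -
  define q where "q = sqrt (real K)"
  have q: "q > 0" "real K = q * q" using K by (auto simp: q_def)
  define B where "B = Zbound \<epsilon> K \<rho>"
  define T where "T = sqrt (2 * \<rho>) * \<nu>g * (B / q) + 2 * so * \<rho> / q + (\<kappa>f\<^sup>2 + \<nu>g\<^sup>2 + R\<^sup>2) / 2 / q"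
  define avg where "avg = (\<lambda>\<omega>. (1 / real K) *\<^sub>R (\<Sum>k<K. X k \<omega>))"
  define good where "good = {\<omega> \<in> space M. fbar (avg \<omega>) - fbar y \<le> T}"
  have [measurable]: "avg \<in> borel_measurable M" unfolding avg_def by measurable
  have good_ev [measurable]: "good \<in> events" unfolding good_def by measurable
  define N1 where "N1 = {\<omega> \<in> space M. (\<Sum>k<K. (- 1) * (F (X k \<omega>) (\<xi> k \<omega>) - fbar (X k \<omega>))) \<ge> \<rho> * so * q}"
  define N2 where "N2 = {\<omega> \<in> space M. (\<Sum>k<K. 1 * (F y (\<xi> k \<omega>) - fbar y)) \<ge> \<rho> * so * q}"
  define N3 where "N3 = {\<omega> \<in> space M. (\<Sum>k<K. \<Sum>i=1..p. Lam k \<omega> i * G i y (\<xi> k \<omega>))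
      > sqrt (2 * \<rho>) * q * (\<nu>g * B)}"
  have [measurable]: "N1 \<in> events" "N2 \<in> events" "N3 \<in> events"
    unfolding N1_def N2_def N3_def by measurable
  have P1: "prob N1 \<le> exp (- \<rho>\<^sup>2 / 3)"
    unfolding N1_def q_def using K by (intro objective_noise_tail X_hist X_in_C so subgauss \<rho>) auto
  have P2: "prob N2 \<le> exp (- \<rho>\<^sup>2 / 3)"
    unfolding N2_def q_def using K y(1)
    by (intro objective_noise_tail[of "\<lambda>_ _. y"] so subgauss \<rho>) auto
  have P3: "prob N3 \<le> 2 * exp (- \<rho>)"
    unfolding N3_def q_def B_def by (rule multiplier_term_bound[OF \<sigma> \<alpha> K \<rho> w \<epsilon> y])
  \<comment> \<open>Only an almost sure inclusion is available, because the samples lie in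
    \<open>\<Xi>\<close> only almost surely.\<close>
  have "AE \<omega> in M. \<omega> \<in> space M - good \<longrightarrow> \<omega> \<in> N1 \<union> N2 \<union> N3"
    using AE_sample AE_space
  proof eventually_elim
    case (elim \<omega>)
    show ?case
    proof (rule impI, rule ccontr)
      assume bad: "\<omega> \<in> space M - good" and "\<omega> \<notin> N1 \<union> N2 \<union> N3"
      then have n1: "(\<Sum>k<K. fbar (X k \<omega>) - F (X k \<omega>) (\<xi> k \<omega>)) \<le> \<rho> * so * q"
        and n2: "(\<Sum>k<K. F y (\<xi> k \<omega>) - fbar y) \<le> \<rho> * so * q"
        and n3: "(\<Sum>k<K. \<Sum>i=1..p. Lam k \<omega> i * G i y (\<xi> k \<omega>)) \<le> sqrt (2 * \<rho>) * q * (\<nu>g * B)"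
        using elim(2) by (auto simp: N1_def N2_def N3_def not_le not_less)
      have "fbar (avg \<omega>) \<le> (\<Sum>k<K. (1 / real K) * fbar (X k \<omega>))"
        unfolding avg_def scaleR_sum_right
        using K by (intro convex_on_sum[OF _ _ convex_on_fbar[OF cvx]])
          (auto simp: X_in_C lessThan_empty_iff)
      also have "\<dots> = (\<Sum>k<K. fbar (X k \<omega>)) / real K"
        by (simp add: sum_divide_distrib)
      finally have "real K * fbar (avg \<omega>) \<le> (\<Sum>k<K. fbar (X k \<omega>))"
        using K by (simp add: field_simps)
      then have "real K * (fbar (avg \<omega>) - fbar y) \<le> (\<Sum>k<K. fbar (X k \<omega>) - fbar y)"
        by (simp add: sum_subtractf algebra_simps)
      \<comment> \<open>The outer sums are the two sampling noises; the middle one is the sampled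
        gap, for which the pathwise estimate holds.\<close>
      also have "\<dots> = (\<Sum>k<K. fbar (X k \<omega>) - F (X k \<omega>) (\<xi> k \<omega>))
          + (\<Sum>k<K. F (X k \<omega>) (\<xi> k \<omega>) - F y (\<xi> k \<omega>)) + (\<Sum>k<K. F y (\<xi> k \<omega>) - fbar y)"
        by (simp add: sum.distrib[symmetric])
      also have "\<dots> \<le> 2 * (\<rho> * so * q) + (real K * (\<kappa>f\<^sup>2 / (2 * \<alpha>) + \<sigma> * \<nu>g\<^sup>2 / 2) + \<alpha> / 2 * R\<^sup>2)
          + sqrt (2 * \<rho>) * q * (\<nu>g * B)"
        using n1 n2 n3 objective_bound[OF elim(1) y(1), of K] by linarith
      also have "\<dots> = real K * T"
        using q by (simp add: T_def \<sigma> \<alpha> q_def[symmetric] field_simps power2_eq_square)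
      finally have "fbar (avg \<omega>) - fbar y \<le> T"
        using K by simp
      then show False using bad by (simp add: good_def)
    qed
  qed
  then have "prob (space M - good) \<le> prob (N1 \<union> N2 \<union> N3)"
    by (intro finite_measure_mono_AE) auto
  also have "\<dots> \<le> prob (N1 \<union> N2) + prob N3"
    by (intro measure_Un_le) auto
  finally have "prob (space M - good) \<le> prob (N1 \<union> N2) + prob N3" .
  moreover have "prob (N1 \<union> N2) \<le> prob N1 + prob N2"
    by (intro measure_Un_le) auto
  ultimately have "prob (space M - good) \<le> 2 * exp (- \<rho>\<^sup>2 / 3) + 2 * exp (- \<rho>)"
    using P1 P2 P3 by linarith
  then have "prob good \<ge> 1 - 2 * exp (- \<rho>\<^sup>2 / 3) - 2 * exp (- \<rho>)"
    by (simp add: prob_compl[OF good_ev])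
  then show ?thesis
    by (simp add: good_def avg_def T_def B_def q_def)
qed

end

section \<open>Specialization to the stated step sizes and constants\<close>

theorem theorem3:
  fixes C :: "'a::euclidean_space set"
    and \<Xi> :: "'q::euclidean_space set"
    and \<mu> :: "'q measure"
    and M :: "'w measure"
    and \<xi> :: "nat \<Rightarrow> 'w \<Rightarrow> 'q"
    and F :: "'a \<Rightarrow> 'q \<Rightarrow> real"
    and G :: "nat \<Rightarrow> 'a \<Rightarrow> 'q \<Rightarrow> real"
    and v0 :: "'a \<Rightarrow> 'q \<Rightarrow> 'a"
    and v :: "nat \<Rightarrow> 'a \<Rightarrow> 'q \<Rightarrow> 'a"
    and f :: "'a \<Rightarrow> real"
    and g :: "nat \<Rightarrow> 'a \<Rightarrow> real"
    and \<Phi> :: "'a set"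
    and p K :: nat
    and x0 xhat xstar :: 'a
    and R \<nu>g \<kappa>f \<kappa>g \<epsilon>0 \<sigma>o \<rho> :: real
    and \<beta>0 \<kappa>0 \<kappa>1 \<kappa>2 \<kappa>3 \<theta>5 :: real
  assumes C: "C \<noteq> {}" "compact C" "convex C"
    \<comment> \<open>probability model: xi^0, xi^1, ... i.i.d. copies of xi, whose law mu is supported on Xi\<close>
    and M: "prob_space M"
    and \<xi>_meas: "\<And>k. \<xi> k \<in> M \<rightarrow>\<^sub>M borel"
    and \<xi>_indep: "prob_space.indep_vars M (\<lambda>_. borel) \<xi> UNIV"
    and \<xi>_law: "\<And>k. distr M borel (\<xi> k) = \<mu>"
    and \<Xi>_supp: "AE z in \<mu>. z \<in> \<Xi>"
    \<comment> \<open>regularity (implicit in the paper): joint Borel measurability of the data\<close>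
    and F_meas: "(\<lambda>(x, z). F x z) \<in> borel_measurable borel"
    and G_meas: "\<And>i. (\<lambda>(x, z). G i x z) \<in> borel_measurable borel"
    and v0_meas: "(\<lambda>(x, z). v0 x z) \<in> borel_measurable borel"
    and v_meas: "\<And>i. (\<lambda>(x, z). v i x z) \<in> borel_measurable borel"
    \<comment> \<open>convexity and continuity in x for every sample value\<close>
    and F_cvx: "\<And>z. z \<in> \<Xi> \<Longrightarrow> convex_on C (\<lambda>x. F x z) \<and> continuous_on C (\<lambda>x. F x z)"
    and G_cvx: "\<And>i z. i \<in> {1..p} \<Longrightarrow> z \<in> \<Xi> \<Longrightarrow>
                   convex_on C (\<lambda>x. G i x z) \<and> continuous_on C (\<lambda>x. G i x z)"
    \<comment> \<open>expectations are finite and define f and g_i\<close>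
    and F_int: "\<And>x. x \<in> C \<Longrightarrow> integrable \<mu> (F x)"
    and G_int: "\<And>i x. i \<in> {1..p} \<Longrightarrow> x \<in> C \<Longrightarrow> integrable \<mu> (G i x)"
    and f_def: "\<And>x. x \<in> C \<Longrightarrow> f x = (\<integral>z. F x z \<partial>\<mu>)"
    and g_def: "\<And>i x. i \<in> {1..p} \<Longrightarrow> x \<in> C \<Longrightarrow> g i x = (\<integral>z. G i x z \<partial>\<mu>)"
    and \<Phi>_def: "\<Phi> = {x \<in> C. \<forall>i\<in>{1..p}. g i x \<le> 0}"
    \<comment> \<open>stochastic subgradients\<close>
    and v0_sub: "\<And>x z. x \<in> C \<Longrightarrow> z \<in> \<Xi> \<Longrightarrow> is_subgrad_on C (\<lambda>y. F y z) x (v0 x z)"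
    and v_sub: "\<And>i x z. i \<in> {1..p} \<Longrightarrow> x \<in> C \<Longrightarrow> z \<in> \<Xi> \<Longrightarrow>
                   is_subgrad_on C (\<lambda>y. G i y z) x (v i x z)"
    \<comment> \<open>(A1)\<close>
    and A1: "\<And>x' x''. x' \<in> C \<Longrightarrow> x'' \<in> C \<Longrightarrow> norm (x' - x'') \<le> R"
    \<comment> \<open>(A2)\<close>
    and A2: "\<And>x z. x \<in> C \<Longrightarrow> z \<in> \<Xi> \<Longrightarrow> sqrt (\<Sum>i=1..p. (G i x z)\<^sup>2) \<le> \<nu>g"
    \<comment> \<open>(A3)\<close>
    and A3f: "\<And>x z. x \<in> C \<Longrightarrow> z \<in> \<Xi> \<Longrightarrow> norm (v0 x z) \<le> \<kappa>f"
    and A3g: "\<And>i x z. i \<in> {1..p} \<Longrightarrow> x \<in> C \<Longrightarrow> z \<in> \<Xi> \<Longrightarrow> norm (v i x z) \<le> \<kappa>g"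
    \<comment> \<open>(A4) Slater\<close>
    and A4: "\<epsilon>0 > 0" "xhat \<in> C" "\<And>i. i \<in> {1..p} \<Longrightarrow> g i xhat \<le> - \<epsilon>0"
    \<comment> \<open>(A6) sub-Gaussian objective noise\<close>
    and A6: "\<sigma>o > 0"
      "\<And>x. x \<in> C \<Longrightarrow> (\<integral>\<^sup>+ z. ennreal (exp (\<bar>F x z - f x\<bar>\<^sup>2 / \<sigma>o\<^sup>2)) \<partial>\<mu>) \<le> ennreal (exp 1)"
    \<comment> \<open>constants\<close>
    and \<beta>0_def: "\<beta>0 = \<nu>g + sqrt (real p) * \<kappa>g * R"
    and \<kappa>0_def: "\<kappa>0 = 2 * \<kappa>f * R / \<epsilon>0"
    and \<kappa>1_def: "\<kappa>1 = R\<^sup>2 / \<epsilon>0"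
    and \<kappa>2_def: "\<kappa>2 = \<nu>g\<^sup>2 / \<epsilon>0 - \<beta>0"
    and \<kappa>3_def: "\<kappa>3 = 2 * \<beta>0 + \<epsilon>0 / 2 + 8 * \<beta>0\<^sup>2 / \<epsilon>0 * ln (32 * \<beta>0\<^sup>2 / \<epsilon>0\<^sup>2)"
    and \<theta>5_def: "\<theta>5 = (\<kappa>f\<^sup>2 + \<nu>g\<^sup>2 + R\<^sup>2) / 2"
    \<comment> \<open>run: K >= 1, alpha = sqrt K, sigma = 1 / sqrt K, x^0 in C\<close>
    and K: "K \<ge> 1"
    and x0: "x0 \<in> C"
    \<comment> \<open>x* is an optimal solution of min {f x | x in Phi}\<close>
    and xstar: "xstar \<in> \<Phi>" "\<And>x. x \<in> \<Phi> \<Longrightarrow> f xstar \<le> f x"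
    and \<rho>: "\<rho> \<ge> 0"
  shows "prob_space.prob M
           {\<omega> \<in> space M.
              f ((1 / real K) *\<^sub>R
                   (\<Sum>k<K. fst (slpmm_iter C F G v0 v p (1 / sqrt (real K)) (sqrt (real K)) x0
                                 (\<lambda>j. \<xi> j \<omega>) k)))
              - f xstar
              \<le> sqrt (2 * \<rho>) * \<nu>g *
                   ((\<kappa>0 + \<kappa>1 + 2 * \<kappa>3) / sqrt (real K)
                    + (16 * \<beta>0\<^sup>2 / \<epsilon>0 * (\<rho> + ln (real K))) / sqrt (real K)
                    + \<kappa>2 / real K)
                + 2 * \<sigma>o * \<rho> / sqrt (real K)
                + \<theta>5 / sqrt (real K)}
         \<ge> 1 - 2 * exp (- \<rho>\<^sup>2 / 3) - 2 * exp (- \<rho>)"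
proof (cases "\<rho> = 0")
  case True
  \<comment> \<open>At \<open>\<rho> = 0\<close> the claimed lower bound is \<open>- 3\<close>; the
    Chernoff parameters of the main argument require \<open>\<rho> > 0\<close>.\<close>
  then show ?thesis
    by (intro order_trans[OF _ measure_nonneg]) simp
next
  case False
  then have \<rho>_pos: "\<rho> > 0" using \<rho> by simp
  interpret M: prob_space M by (rule M)
  have "prob_space \<mu>"
    unfolding \<xi>_law[of 0, symmetric] by (rule M.prob_space_distr[OF \<xi>_meas])
  then interpret \<mu>: prob_space \<mu> .
  have "\<Xi> \<noteq> {}"
    using \<Xi>_supp \<mu>.not_empty by (auto simp: \<mu>.AE_const)
  interpret P: slpmm_process C F G v0 v p "1 / sqrt (real K)" "sqrt (real K)" \<Xi> R \<nu>g \<kappa>f \<kappa>g M \<xi> \<mu> x0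
    by unfold_locales
       (use C K \<xi>_indep \<xi>_law \<Xi>_supp F_meas G_meas v0_meas v_meas F_int G_int v0_sub v_sub A1 A2 A3f A3g
          x0 \<open>\<Xi> \<noteq> {}\<close> in \<open>auto simp: L2_set_def\<close>)
  have f_eq: "f x = P.fbar x" if "x \<in> C" for x
    using f_def[OF that] by (simp add: P.fbar_def)
  have star: "xstar \<in> C" "\<And>i. i \<in> {1..p} \<Longrightarrow> (\<integral>z. G i xstar z \<partial>\<mu>) \<le> 0"
    using xstar(1) g_def by (auto simp: \<Phi>_def)
  have slater: "(\<integral>z. G i xhat z \<partial>\<mu>) \<le> - \<epsilon>0" if "i \<in> {1..p}" for i
    using A4(3)[OF that] g_def[OF that A4(2)] by simp
  \<comment> \<open>Since \<open>f\<close> agrees with \<open>fbar\<close> on \<open>C\<close> only,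
    the averaged iterate must be known to stay in \<open>C\<close> before the two are
    exchanged.\<close>
  have avg: "(1 / real K) *\<^sub>R (\<Sum>k<K. P.X k \<omega>) \<in> C" for \<omega>
    unfolding scaleR_sum_right using K C by (intro convex_sum) (auto simp: P.X_in_C)
  have \<beta>: "P.\<beta> = \<beta>0"
    by (simp add: P.\<beta>_def \<beta>0_def)
  have bound: "sqrt (2 * \<rho>) * \<nu>g * (P.Zbound \<epsilon>0 K \<rho> / sqrt (real K)) + 2 * \<sigma>o * \<rho> / sqrt (real K)
        + (\<kappa>f\<^sup>2 + \<nu>g\<^sup>2 + R\<^sup>2) / 2 / sqrt (real K)
      = sqrt (2 * \<rho>) * \<nu>g * ((\<kappa>0 + \<kappa>1 + 2 * \<kappa>3) / sqrt (real K)
          + (16 * \<beta>0\<^sup>2 / \<epsilon>0 * (\<rho> + ln (real K))) / sqrt (real K) + \<kappa>2 / real K)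
        + 2 * \<sigma>o * \<rho> / sqrt (real K) + \<theta>5 / sqrt (real K)"
  proof -
    have "\<kappa>2 / sqrt (real K) / sqrt (real K) = \<kappa>2 / real K"
      by simp
    moreover have "P.Zbound \<epsilon>0 K \<rho> = (\<kappa>0 + \<kappa>1 + 2 * \<kappa>3) + 16 * \<beta>0\<^sup>2 / \<epsilon>0 * (\<rho> + ln (real K))
        + \<kappa>2 / sqrt (real K)"
      by (simp add: P.Zbound_def P.\<kappa>3_def \<beta> \<kappa>0_def \<kappa>1_def \<kappa>2_def \<kappa>3_def)
    ultimately have "P.Zbound \<epsilon>0 K \<rho> / sqrt (real K) = (\<kappa>0 + \<kappa>1 + 2 * \<kappa>3) / sqrt (real K)
          + (16 * \<beta>0\<^sup>2 / \<epsilon>0 * (\<rho> + ln (real K))) / sqrt (real K) + \<kappa>2 / real K"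
      by (simp only: add_divide_distrib)
    then show ?thesis
      by (simp only: \<theta>5_def)
  qed
  have "measure M {\<omega> \<in> space M. P.fbar ((1 / real K) *\<^sub>R (\<Sum>k<K. P.X k \<omega>)) - P.fbar xstar
      \<le> sqrt (2 * \<rho>) * \<nu>g * (P.Zbound \<epsilon>0 K \<rho> / sqrt (real K)) + 2 * \<sigma>o * \<rho> / sqrt (real K)
        + (\<kappa>f\<^sup>2 + \<nu>g\<^sup>2 + R\<^sup>2) / 2 / sqrt (real K)} \<ge> 1 - 2 * exp (- \<rho>\<^sup>2 / 3) - 2 * exp (- \<rho>)"
    using F_cvx A6 by (intro P.objective_gap_tail[OF refl refl K \<rho>_pos A4(2,1) slater star]) (auto simp: f_eq)
  then show ?thesis
    unfolding bound f_eq[OF avg, symmetric] f_eq[OF star(1), symmetric] by (simp only: P.X_def)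
qed

end
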